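(* Let $\gamma=(\gamma_n)_{n\ge 1}$ be a sequence of complex numbers, and define the formal power series \[ \Gamma_\gamma(z):=\sum_{n\ge 1}\gamma_n z^n, \qquad L_\gamma(z):=\sum_{n\ge 1}\gamma_n\frac{z^n}{1-z^n}. \] If both $\Gamma_\gamma(z)$ and $L_\gamma(z)$ are rational, then $\Gamma_\gamma(z)$ is a polynomial. Equivalently, among sequences $\gamma$ for which $\Gamma_\gamma(z)$ is rational, the only ones for which $L_\gamma(z)$ is rational are the finitely supported sequences.
   Context: A formal power series in $\mathbb{C}[[z]]$ is called rational if it is the power series expansion at $z=0$ of a rational function in $\mathbb{C}(z)$. Each summand $\frac{z^n}{1-z^n}$ is expanded as $\sum_{k\ge 1}z^{nk}$, so that $L_\gamma(z)=\sum_{m\ge 1}\bigl(\sum_{d\mid m}\gamma_d\bigr)z^m$ as a formal power series. A sequence is finitely supported if all but finitely many of its terms are zero. *)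

theory Defs
  imports Complex_Main "HOL-Computational_Algebra.Computational_Algebra"
begin

text \<open>
  A rational function has a power series expansion at 0 iff 0 is not a pole, i.e. iff it can be
  written with a denominator that does not vanish at 0. For such a denominator the division
  of formal power series below is multiplication by the multiplicative inverse.
\<close>

definition fps_rational :: "complex fps \<Rightarrow> bool" where
  "fps_rational F \<longleftrightarrow>
     (\<exists>p q :: complex poly. poly q 0 \<noteq> 0 \<and> F = fps_of_poly p / fps_of_poly q)"

text \<open>
  Sequences are indexed from 1: the value at 0 of a function on the naturals is ignored throughout.
\<close>

definition Gamma_fps :: "(nat \<Rightarrow> complex) \<Rightarrow> complex fps" where
  "Gamma_fps \<gamma> = Abs_fps (\<lambda>n. if n = 0 then 0 else \<gamma> n)"

text \<open>
  The series is summed in the usual topology of formal power series (eventual constancy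
  of every coefficient); it always converges, see the lemmas below.
\<close>

definition Lambert_fps :: "(nat \<Rightarrow> complex) \<Rightarrow> complex fps" where
  "Lambert_fps \<gamma> =
     (\<Sum>n. fps_const (\<gamma> (Suc n)) * (fps_X ^ Suc n / (1 - fps_X ^ Suc n)))"

definition finitely_supported :: "(nat \<Rightarrow> complex) \<Rightarrow> bool" where
  "finitely_supported \<gamma> \<longleftrightarrow> finite {n. n \<ge> 1 \<and> \<gamma> n \<noteq> 0}"

lemma Lambert_summand:
  assumes "n > 0"
  shows "(fps_X ^ n / (1 - fps_X ^ n) :: complex fps) =
           Abs_fps (\<lambda>m. if m > 0 \<and> n dvd m then 1 else 0)"
proof -
  let ?G = "Abs_fps (\<lambda>m. if m > 0 \<and> n dvd m then 1 else 0) :: complex fps"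
  have "?G * (1 - fps_X ^ n) = fps_X ^ n"
  proof (rule fps_ext)
    fix m
    have "(?G * (1 - fps_X ^ n)) $ m = ?G $ m - (if m < n then 0 else ?G $ (m - n))"
      by (simp add: algebra_simps fps_X_power_mult_nth)
    also have "\<dots> = (fps_X ^ n :: complex fps) $ m"
    proof (cases "m < n")
      case True
      then have "\<not> (m > 0 \<and> n dvd m)"
        by (auto dest: dvd_imp_le)
      with True show ?thesis by auto
    next
      case False
      then have "n dvd (m - n) \<longleftrightarrow> n dvd m"
        by (simp add: dvd_minus_self)
      with False assms show ?thesis by auto
    qed
    finally show "(?G * (1 - fps_X ^ n)) $ m = (fps_X ^ n :: complex fps) $ m" .
  qed
  moreover have "(1 - fps_X ^ n :: complex fps) $ 0 = 1"
    using assms by simp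
  then have "(1 - fps_X ^ n :: complex fps) \<noteq> 0"
    by (metis fps_zero_nth zero_neq_one)
  ultimately show ?thesis
    by (metis nonzero_mult_div_cancel_right)
qed

lemma Lambert_sums:
  "(\<lambda>n. fps_const (\<gamma> (Suc n)) * (fps_X ^ Suc n / (1 - fps_X ^ Suc n))) sums
     Abs_fps (\<lambda>m. if m = 0 then 0 else (\<Sum>d | d dvd m. \<gamma> d) :: complex)"
  unfolding sums_def
proof (rule tendsto_fpsI)
  fix m
  let ?t = "\<lambda>n. fps_const (\<gamma> (Suc n)) * (fps_X ^ Suc n / (1 - fps_X ^ Suc n)) :: complex fps"
  let ?S = "Abs_fps (\<lambda>m. if m = 0 then 0 else (\<Sum>d | d dvd m. \<gamma> d) :: complex)"
  have "(\<Sum>n<N. ?t n) $ m = ?S $ m" if "N \<ge> m" for N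
  proof -
    have "(\<Sum>n<N. ?t n) $ m = (\<Sum>n<N. if m > 0 \<and> Suc n dvd m then \<gamma> (Suc n) else 0)"
      by (simp add: fps_sum_nth Lambert_summand if_distrib del: power_Suc cong: if_cong)
    also have "\<dots> = (\<Sum>d\<in>Suc ` {..<N}. if m > 0 \<and> d dvd m then \<gamma> d else 0)"
      by (simp add: sum.reindex)
    also have "\<dots> = ?S $ m"
    proof (cases "m = 0")
      case False
      have "{d \<in> Suc ` {..<N}. d dvd m} = {d. d dvd m}"
      proof (intro equalityI subsetI)
        fix d assume "d \<in> {d. d dvd m}"
        then have "d \<le> m" "d > 0" "d dvd m"
          using False by (auto dest: dvd_imp_le intro: Nat.gr0I)
        with that show "d \<in> {d \<in> Suc ` {..<N}. d dvd m}"
          by (cases d) auto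
      qed auto
      with False show ?thesis
        by (simp add: sum.inter_filter[symmetric])
    qed simp
    finally show ?thesis .
  qed
  then show "\<forall>\<^sub>F N in sequentially. (\<Sum>n<N. ?t n) $ m = ?S $ m"
    by (intro eventually_sequentiallyI[of m])
qed

lemma Lambert_fps_eq:
  "Lambert_fps \<gamma> = Abs_fps (\<lambda>m. if m = 0 then 0 else (\<Sum>d | d dvd m. \<gamma> d))"
  unfolding Lambert_fps_def using Lambert_sums by (rule sums_unique[symmetric])

end

theory Submission
  imports "HOL-Number_Theory.Number_Theory" Defs
begin

text \<open>
  Write \<open>u\<close> for the coefficients of the first series and \<open>a\<close> for those of the Lambert series, so that
  \<open>a n\<close> is the sum of \<open>u d\<close> over the divisors \<open>d\<close> of \<open>n\<close>. Rationality of both series means that \<open>u\<close> and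
  \<open>a\<close> satisfy linear recurrences, that of \<open>u\<close> holding from an index \<open>m\<close> on and having a nonzero
  trailing coefficient \<open>c 0\<close>. The claim is that then \<open>u n = 0\<close> for all positive \<open>n \<ge> m\<close>.

  The idea is to reduce modulo ideals with finite residue field. All terms and all recurrence
  coefficients lie in one finitely generated subring \<open>R\<close> of the complex numbers. If \<open>u n \<noteq> 0\<close> for some
  positive \<open>n \<ge> m\<close>, then \<open>c 0 * u n\<close> is a nonzero element of \<open>R\<close>, and by a form of the Nullstellensatz
  over the integers (\<open>finitely_generated_residually_finite\<close>) it stays nonzero in some finite residue
  field \<open>R / I\<close>. A recurrence over a finite field runs through finitely many states, so \<open>u\<close> and \<open>a\<close> become
  eventually periodic modulo \<open>I\<close>, with a common period \<open>P\<close>; since \<open>c 0\<close> is invertible modulo \<open>I\<close>, the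
  recurrence of \<open>u\<close> also runs backwards and \<open>u\<close> is periodic from \<open>m\<close> on.

  For periodic sequences the claim is elementary (\<open>periodic_divisor_sum_vanishes\<close>). Let \<open>w\<close> be the
  purely periodic sequence that agrees with \<open>u\<close> modulo \<open>I\<close> from \<open>m\<close> on, let \<open>d > 0\<close>, and let \<open>p\<close> be a large
  prime with \<open>p \<equiv> 1\<close> modulo \<open>P\<close>. The divisors of \<open>d * p\<^sup>2\<close> that do not divide \<open>d * p\<close> are the numbers
  \<open>e * p\<^sup>2\<close> with \<open>e\<close> dividing \<open>d\<close>, and \<open>e * p\<^sup>2 \<equiv> e\<close> modulo \<open>P\<close>. Hence the sum of \<open>w e\<close> over the divisors of
  \<open>d\<close> is congruent to \<open>a (d * p\<^sup>2) - a (d * p)\<close>, which vanishes modulo \<open>I\<close> because \<open>d * p\<^sup>2 \<equiv> d * p\<close> modulo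
  \<open>P\<close>. As this holds for all \<open>d\<close>, induction on divisors gives \<open>w = 0\<close> on the positive integers, so that
  \<open>u n \<in> I\<close>, a contradiction.

  In the other direction, the Lambert series of a finitely supported sequence is a finite sum of rational
  functions.
\<close>

section \<open>Subrings, ideals and finite residue fields\<close>

definition is_subring :: "'a :: comm_ring_1 set \<Rightarrow> bool" where
  "is_subring R \<longleftrightarrow> 1 \<in> R \<and> (\<forall>x\<in>R. \<forall>y\<in>R. x - y \<in> R \<and> x * y \<in> R)"

definition is_ideal :: "'a :: comm_ring_1 set \<Rightarrow> 'a set \<Rightarrow> bool" where
  "is_ideal R I \<longleftrightarrow>
     I \<subseteq> R \<and> 0 \<in> I \<and> (\<forall>x\<in>I. \<forall>y\<in>I. x - y \<in> I) \<and> (\<forall>r\<in>R. \<forall>x\<in>I. r * x \<in> I)"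

text \<open>
  Together with \<open>1 \<notin> I\<close> this says that the quotient \<open>R / I\<close> is a field. Quotients are never formed:
  rings and ideals are sets inside one fixed ring, and a computation in \<open>R / I\<close> is a statement about
  differences lying in \<open>I\<close>.
\<close>

definition inverses_mod :: "'a :: comm_ring_1 set \<Rightarrow> 'a set \<Rightarrow> bool" where
  "inverses_mod R I \<longleftrightarrow> (\<forall>a\<in>R - I. \<exists>b\<in>R. a * b - 1 \<in> I)"

definition finite_residue_field :: "'a :: comm_ring_1 set \<Rightarrow> 'a set \<Rightarrow> bool" where
  "finite_residue_field R I \<longleftrightarrow>
     is_ideal R I \<and> 1 \<notin> I \<and> inverses_mod R I \<and>
     (\<exists>S\<subseteq>R. finite S \<and> (\<forall>x\<in>R. \<exists>s\<in>S. x - s \<in> I))"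

lemma subring_closed:
  assumes "is_subring R"
  shows "1 \<in> R" "0 \<in> R" "\<And>x y. x \<in> R \<Longrightarrow> y \<in> R \<Longrightarrow> x - y \<in> R"
    "\<And>x y. x \<in> R \<Longrightarrow> y \<in> R \<Longrightarrow> x * y \<in> R"
    "\<And>x. x \<in> R \<Longrightarrow> - x \<in> R"
    "\<And>x y. x \<in> R \<Longrightarrow> y \<in> R \<Longrightarrow> x + y \<in> R"
    "\<And>x n. x \<in> R \<Longrightarrow> x ^ n \<in> R"
proof -
  show diff: "x - y \<in> R" and mult: "x * y \<in> R" if "x \<in> R" "y \<in> R" for x y
    using assms that by (auto simp: is_subring_def)
  show "1 \<in> R" using assms by (simp add: is_subring_def)
  then show zero: "0 \<in> R" using diff[of 1 1] by simp
  show neg: "- x \<in> R" if "x \<in> R" for x using diff[OF zero that] by simp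
  show "x + y \<in> R" if "x \<in> R" "y \<in> R" for x y using diff[OF that(1) neg[OF that(2)]] by simp
  show "x ^ n \<in> R" if "x \<in> R" for x n
    using that \<open>1 \<in> R\<close> by (induction n) (auto intro: mult)
qed

lemma subring_sum:
  assumes "is_subring R" "\<And>i. i \<in> X \<Longrightarrow> f i \<in> R"
  shows "(\<Sum>i\<in>X. f i) \<in> R"
  using assms(2) by (induction X rule: infinite_finite_induct)
    (auto intro: subring_closed[OF assms(1)])

lemma is_ideal_self: "is_subring R \<Longrightarrow> is_ideal R R"
  by (auto simp: is_ideal_def intro: subring_closed)

lemma ideal_closed:
  assumes "is_ideal R I"
  shows "0 \<in> I" "\<And>x. x \<in> I \<Longrightarrow> x \<in> R"
    "\<And>x y. x \<in> I \<Longrightarrow> y \<in> I \<Longrightarrow> x - y \<in> I"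
    "\<And>x y. x \<in> I \<Longrightarrow> y \<in> I \<Longrightarrow> x + y \<in> I"
    "\<And>x. x \<in> I \<Longrightarrow> - x \<in> I"
    "\<And>r x. r \<in> R \<Longrightarrow> x \<in> I \<Longrightarrow> r * x \<in> I"
    "\<And>r x. r \<in> R \<Longrightarrow> x \<in> I \<Longrightarrow> x * r \<in> I"
proof -
  show zero: "0 \<in> I" and "\<And>x. x \<in> I \<Longrightarrow> x \<in> R"
    and *: "\<And>r x. r \<in> R \<Longrightarrow> x \<in> I \<Longrightarrow> r * x \<in> I"
    using assms by (auto simp: is_ideal_def)
  show "\<And>r x. r \<in> R \<Longrightarrow> x \<in> I \<Longrightarrow> x * r \<in> I"
    using * by (simp add: mult.commute)
  show diff: "x - y \<in> I" if "x \<in> I" "y \<in> I" for x y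
    using assms that by (auto simp: is_ideal_def)
  show neg: "- x \<in> I" if "x \<in> I" for x using diff[OF zero that] by simp
  show "x + y \<in> I" if "x \<in> I" "y \<in> I" for x y using diff[OF that(1) neg[OF that(2)]] by simp
qed

lemma ideal_sum:
  assumes "is_ideal R I" "\<And>i. i \<in> X \<Longrightarrow> f i \<in> I"
  shows "(\<Sum>i\<in>X. f i) \<in> I"
  using assms(2) by (induction X rule: infinite_finite_induct)
    (auto intro: ideal_closed[OF assms(1)])

lemma residue_field_mult:
  assumes "is_subring R" "is_ideal R I" "inverses_mod R I" "x \<in> R" "y \<in> R" "x * y \<in> I" "x \<notin> I"
  shows "y \<in> I"
proof -
  obtain b where b: "b \<in> R" "x * b - 1 \<in> I"
    using assms unfolding inverses_mod_def by blast
  have "b * (x * y) - y * (x * b - 1) \<in> I"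
    using ideal_closed(3)[OF assms(2) ideal_closed(6)[OF assms(2) b(1) assms(6)] ideal_closed(6)[OF assms(2,5) b(2)]] .
  then show ?thesis by (simp add: algebra_simps)
qed

lemma residue_field_power:
  assumes "is_subring R" "is_ideal R I" "inverses_mod R I" "x \<in> R" "1 \<notin> I" "x \<notin> I"
  shows "x ^ k \<notin> I"
proof (induction k)
  case (Suc k)
  then show ?case
    using residue_field_mult[OF assms(1-4), of "x ^ k"] assms
    by (auto intro: subring_closed)
qed (use assms in auto)

text \<open>
  Zorn's lemma gives a maximal proper ideal \<open>J\<close>. An element \<open>a\<close> outside \<open>J\<close> is invertible modulo \<open>J\<close> because
  the ideal generated by \<open>J\<close> and \<open>a\<close> must contain \<open>1\<close>.
\<close>

lemma maximal_ideal_exists: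
  assumes B: "is_subring B" and J0: "is_ideal B J0" "1 \<notin> J0"
  obtains J where "is_ideal B J" "J0 \<subseteq> J" "1 \<notin> J" "inverses_mod B J"
proof -
  define F where "F = {J. is_ideal B J \<and> J0 \<subseteq> J \<and> 1 \<notin> J}"
  have "\<exists>J\<in>F. \<forall>X\<in>F. J \<subseteq> X \<longrightarrow> X = J"
  proof (rule subset_Zorn_nonempty)
    show "F \<noteq> {}" using J0 by (auto simp: F_def)
    fix C assume C: "C \<noteq> {}" "subset.chain F C"
    then have CF: "\<And>X. X \<in> C \<Longrightarrow> is_ideal B X \<and> J0 \<subseteq> X \<and> 1 \<notin> X"
      by (auto simp: subset.chain_def F_def)
    have lin: "X \<subseteq> Y \<or> Y \<subseteq> X" if "X \<in> C" "Y \<in> C" for X Y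
      using C that by (auto simp: subset_chain_def)
    have "x - y \<in> \<Union>C" if xy: "x \<in> \<Union>C" "y \<in> \<Union>C" for x y
    proof -
      obtain X Y where XY: "X \<in> C" "Y \<in> C" "x \<in> X" "y \<in> Y" using xy by blast
      from lin[OF XY(1,2)] obtain Z where "Z \<in> C" "x \<in> Z" "y \<in> Z"
        using XY by blast
      then show ?thesis using CF[of Z] by (auto intro: ideal_closed)
    qed
    moreover have "r * x \<in> \<Union>C" if "r \<in> B" "x \<in> \<Union>C" for r x
      using CF that by (auto intro: ideal_closed)
    moreover have "0 \<in> \<Union>C" "J0 \<subseteq> \<Union>C" "\<Union>C \<subseteq> B" "1 \<notin> \<Union>C"
      using C(1) CF ideal_closed(1,2) by fast+
    ultimately show "\<Union>C \<in> F"
      unfolding F_def is_ideal_def by blast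
  qed
  then obtain J where JF: "J \<in> F" and maxF: "\<And>X. X \<in> F \<Longrightarrow> J \<subseteq> X \<Longrightarrow> X = J"
    by metis
  then have J: "is_ideal B J" "J0 \<subseteq> J" "1 \<notin> J"
    by (auto simp: F_def)
  have max: "X = J" if "is_ideal B X" "1 \<notin> X" "J \<subseteq> X" for X
    using maxF[of X] that J(2) by (auto simp: F_def)
  have "inverses_mod B J"
    unfolding inverses_mod_def
  proof (intro ballI)
    fix a assume a: "a \<in> B - J"
    define X where "X = {x. \<exists>j\<in>J. \<exists>b\<in>B. x = j + a * b}"
    have "is_ideal B X"
      unfolding is_ideal_def
    proof (intro conjI ballI subsetI)
      fix x assume "x \<in> X"
      then show "x \<in> B"
        using a ideal_closed(2)[OF J(1)] by (auto simp: X_def intro!: subring_closed[OF B])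
    next
      show "0 \<in> X"
        unfolding X_def using ideal_closed(1)[OF J(1)] subring_closed(2)[OF B] by force
    next
      fix x y assume "x \<in> X" "y \<in> X"
      then obtain j b j' b' where "j \<in> J" "b \<in> B" "x = j + a * b" "j' \<in> J" "b' \<in> B" "y = j' + a * b'"
        unfolding X_def by blast
      then have "x - y = (j - j') + a * (b - b')" "j - j' \<in> J" "b - b' \<in> B"
        using ideal_closed(3)[OF J(1)] subring_closed(3)[OF B] by (auto simp: algebra_simps)
      then show "x - y \<in> X" unfolding X_def by blast
    next
      fix r x assume r: "r \<in> B" and "x \<in> X"
      then obtain j b where "j \<in> J" "b \<in> B" "x = j + a * b"
        unfolding X_def by blast
      then have "r * x = r * j + a * (r * b)" "r * j \<in> J" "r * b \<in> B"
        using r ideal_closed(6)[OF J(1)] subring_closed(4)[OF B]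
        by (auto simp: distrib_left mult.left_commute)
      then show "r * x \<in> X" unfolding X_def by blast
    qed
    moreover have "J \<subseteq> X"
    proof
      fix j assume "j \<in> J"
      then show "j \<in> X" unfolding X_def using subring_closed(2)[OF B] by force
    qed
    moreover have "a \<in> X"
      unfolding X_def using ideal_closed(1)[OF J(1)] subring_closed(1)[OF B] by force
    ultimately have "1 \<in> X" using max[of X] a by auto
    then obtain j b where "j \<in> J" "b \<in> B" "1 = j + a * b" unfolding X_def by blast
    then have "a * b - 1 = - j" by (simp add: algebra_simps)
    then show "\<exists>b\<in>B. a * b - 1 \<in> J"
      using \<open>j \<in> J\<close> \<open>b \<in> B\<close> ideal_closed(5)[OF J(1)] by metis
  qed
  then show ?thesis using J that by blast
qed

section \<open>Adjoining an element\<close>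

definition polys_over :: "'a :: comm_ring_1 set \<Rightarrow> 'a poly set" where
  "polys_over A = {f. \<forall>i. coeff f i \<in> A}"

definition adjoin :: "'a :: comm_ring_1 set \<Rightarrow> 'a \<Rightarrow> 'a set" where
  "adjoin A t = (\<lambda>f. poly f t) ` polys_over A"

text \<open>
  The choice \<open>I = A\<close> gives the closure properties of the polynomials over the subring itself.
\<close>

lemma polys_over_closed:
  assumes A: "is_subring A" and I: "is_ideal A I"
  shows "0 \<in> polys_over I"
    "\<And>f g. f \<in> polys_over I \<Longrightarrow> g \<in> polys_over I \<Longrightarrow> f - g \<in> polys_over I"
    "\<And>f g. f \<in> polys_over I \<Longrightarrow> g \<in> polys_over I \<Longrightarrow> f + g \<in> polys_over I"
    "\<And>f g. f \<in> polys_over A \<Longrightarrow> g \<in> polys_over I \<Longrightarrow> f * g \<in> polys_over I"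
    "\<And>c g. c \<in> A \<Longrightarrow> g \<in> polys_over I \<Longrightarrow> smult c g \<in> polys_over I"
    "\<And>c g. c \<in> I \<Longrightarrow> g \<in> polys_over A \<Longrightarrow> smult c g \<in> polys_over I"
    "\<And>c n. c \<in> I \<Longrightarrow> monom c n \<in> polys_over I"
    "\<And>c f. c \<in> I \<Longrightarrow> f \<in> polys_over I \<Longrightarrow> pCons c f \<in> polys_over I"
  using ideal_closed[OF I]
  by (auto simp: polys_over_def coeff_mult coeff_pCons split: nat.split intro!: ideal_sum[OF I])

lemma polys_overD: "f \<in> polys_over A \<Longrightarrow> coeff f i \<in> A"
  by (simp add: polys_over_def)

lemma polys_over_mono: "I \<subseteq> A \<Longrightarrow> polys_over I \<subseteq> polys_over A"
  by (auto simp: polys_over_def)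

lemma poly_mem_ideal:
  assumes A: "is_subring A" and q: "q \<in> polys_over A" and x: "x \<in> A"
  shows "poly q x \<in> A"
  unfolding poly_altdef using q x
  by (intro subring_sum[OF A] subring_closed[OF A]) (auto simp: polys_overD)

lemma adjoin_subring:
  assumes A: "is_subring A"
  shows "is_subring (adjoin A t)" "A \<subseteq> adjoin A t" "t \<in> adjoin A t"
proof -
  note cl = polys_over_closed[OF A is_ideal_self[OF A]] subring_closed[OF A]
  have c: "[:c:] \<in> polys_over A" if "c \<in> A" for c
    using that by (intro cl)
  have mem: "poly f t \<in> adjoin A t" if "f \<in> polys_over A" for f
    using that by (auto simp: adjoin_def)
  show "A \<subseteq> adjoin A t"
    using mem[OF c] by auto
  then have "1 \<in> adjoin A t" using subring_closed(1)[OF A] by auto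
  moreover have "x - y \<in> adjoin A t \<and> x * y \<in> adjoin A t"
    if xy: "x \<in> adjoin A t" "y \<in> adjoin A t" for x y
  proof -
    obtain f g where "f \<in> polys_over A" "g \<in> polys_over A" "x = poly f t" "y = poly g t"
      using xy by (auto simp: adjoin_def)
    then show ?thesis
      using mem[of "f - g"] mem[of "f * g"] cl(2,4) by auto
  qed
  ultimately show "is_subring (adjoin A t)" by (auto simp: is_subring_def)
  have "[:0, 1:] \<in> polys_over A" by (intro cl)
  from mem[OF this] show "t \<in> adjoin A t" by simp
qed

text \<open>
  Pseudo-division that tracks an ideal: if the dividend has its coefficients in \<open>I\<close>, so has the
  remainder. Each step replaces \<open>f\<close> by its multiple with the leading coefficient of \<open>g\<close>, minus a
  multiple of \<open>g\<close> that cancels the top term.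
\<close>

lemma pseudo_division:
  fixes g :: "'a :: idom poly"
  assumes A: "is_subring A" and I: "is_ideal A I"
    and g: "g \<in> polys_over A" "degree g > 0" and f: "f \<in> polys_over I"
  shows "\<exists>k q r. smult (lead_coeff g ^ k) f = q * g + r \<and>
           q \<in> polys_over A \<and> r \<in> polys_over I \<and> degree r < degree g"
  using f
proof (induction "degree f" arbitrary: f rule: less_induct)
  case less
  note clA = polys_over_closed[OF A is_ideal_self[OF A]]
  note clI = polys_over_closed[OF A I]
  show ?case
  proof (cases "degree f < degree g")
    case True
    have "smult (lead_coeff g ^ 0) f = 0 * g + f" by simp
    then show ?thesis using less.prems True clA(1) by blast
  next
    case False
    define h where "h = monom (lead_coeff f) (degree f - degree g)"
    define f' where "f' = smult (lead_coeff g) f - h * g"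
    have lf: "lead_coeff f \<in> I" using less.prems by (simp add: polys_overD)
    have h: "h \<in> polys_over I" unfolding h_def by (intro clI lf)
    then have hA: "h \<in> polys_over A"
      using polys_over_mono[of I A] ideal_closed(2)[OF I] by blast
    have "f' \<in> polys_over I"
      unfolding f'_def using less.prems g clI(4)[OF g(1) h]
      by (intro clI(2,5)) (auto simp: polys_overD mult.commute)
    moreover have "degree f' < degree f"
    proof -
      have d: "f \<noteq> 0" "g \<noteq> 0" using False g by auto
      then have "degree (h * g) = degree f"
        using False by (simp add: h_def degree_mult_eq degree_monom_eq monom_eq_0_iff)
      moreover have "coeff (h * g) (degree f) = lead_coeff g * lead_coeff f"
        using False by (simp add: h_def coeff_monom_mult)
      ultimately have "coeff f' (degree f) = 0" "degree f' \<le> degree f"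
        by (auto simp: f'_def intro!: degree_diff_le)
      moreover have "degree f > 0" using False g by simp
      ultimately show ?thesis
        by (metis degree_0 eq_zero_or_degree_less)
    qed
    ultimately obtain k q r where kqr: "smult (lead_coeff g ^ k) f' = q * g + r"
       "q \<in> polys_over A" "r \<in> polys_over I" "degree r < degree g"
      using less.hyps by blast
    have "smult (lead_coeff g ^ Suc k) f = (q + smult (lead_coeff g ^ k) h) * g + r"
      using kqr(1) by (simp add: f'_def smult_diff_right algebra_simps)
    moreover have "q + smult (lead_coeff g ^ k) h \<in> polys_over A"
      using kqr hA g by (intro clA subring_closed[OF A]) (auto simp: polys_overD)
    ultimately show ?thesis using kqr by blast
  qed
qed

lemma minimal_polynomial:
  fixes t :: "'a :: idom"
  assumes A: "is_subring A" and h: "h \<in> polys_over A" "h \<noteq> 0" "poly h t = 0"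
  obtains g where "g \<in> polys_over A" "degree g > 0" "poly g t = 0"
    "\<And>r. r \<in> polys_over A \<Longrightarrow> degree r < degree g \<Longrightarrow> poly r t = 0 \<Longrightarrow> r = 0"
proof -
  define P where "P g \<longleftrightarrow> g \<in> polys_over A \<and> g \<noteq> 0 \<and> poly g t = 0" for g
  have "P h" using h by (simp add: P_def)
  define g where "g = arg_min degree P"
  have g: "P g" "\<And>h. P h \<Longrightarrow> degree g \<le> degree h"
    unfolding g_def using arg_min_nat_lemma[of P h degree, OF \<open>P h\<close>] by auto
  have "degree g > 0"
  proof (rule ccontr)
    assume "\<not> degree g > 0"
    then obtain c where "g = [:c:]" by (metis degree_eq_zeroE gr0I)
    then show False using g(1) by (simp add: P_def)
  qed
  moreover have "r = 0" if "r \<in> polys_over A" "degree r < degree g" "poly r t = 0" for r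
    using g(2)[of r] that by (auto simp: P_def)
  ultimately show ?thesis using that g(1) unfolding P_def by blast
qed

text \<open>
  The pseudo-remainder of \<open>h\<close> modulo \<open>g\<close> again vanishes at \<open>t\<close>, and its degree is too small for that.
\<close>

lemma minimal_polynomial_divides:
  fixes t :: "'a :: idom"
  assumes A: "is_subring A" and g: "g \<in> polys_over A" "degree g > 0" "poly g t = 0"
    and min: "\<And>r. r \<in> polys_over A \<Longrightarrow> degree r < degree g \<Longrightarrow> poly r t = 0 \<Longrightarrow> r = 0"
    and h: "h \<in> polys_over A" "poly h t = 0"
  obtains c q where "c \<in> A" "c \<noteq> 0" "q \<in> polys_over A" "smult c h = q * g"
proof -
  obtain k q r where kqr: "smult (lead_coeff g ^ k) h = q * g + r"
    "q \<in> polys_over A" "r \<in> polys_over A" "degree r < degree g"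
    using pseudo_division[OF A is_ideal_self[OF A] g(1,2) h(1)] by blast
  have "poly r t = 0" using arg_cong[OF kqr(1), of "\<lambda>p. poly p t"] g h by simp
  then have "r = 0" using min kqr by blast
  moreover have "lead_coeff g ^ k \<noteq> 0" "lead_coeff g ^ k \<in> A"
    using g by (auto intro!: subring_closed[OF A] simp: polys_overD)
  ultimately show ?thesis using that kqr by simp
qed

text \<open>
  If \<open>t\<close> is algebraic over \<open>A\<close>, every nonzero \<open>x\<close> in \<open>A[t]\<close> divides a nonzero element of \<open>A\<close>. Among the
  polynomials whose value at \<open>t\<close> is a nonzero multiple of \<open>x\<close>, one of minimal degree is constant:
  otherwise pseudo-division of the minimal polynomial \<open>g\<close> by it would leave a remainder that
  vanishes at \<open>t\<close>, hence a quotient that vanishes at \<open>t\<close> and has smaller degree than \<open>g\<close>.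
\<close>

lemma algebraic_divides_base:
  fixes g :: "'a :: idom poly"
  assumes A: "is_subring A" and g: "g \<in> polys_over A" "degree g > 0" "poly g t = 0"
    and min: "\<And>r. r \<in> polys_over A \<Longrightarrow> degree r < degree g \<Longrightarrow> poly r t = 0 \<Longrightarrow> r = 0"
    and x: "x \<in> adjoin A t" "x \<noteq> 0"
  obtains y where "y \<in> adjoin A t" "x * y \<in> A" "x * y \<noteq> 0"
proof -
  let ?B = "adjoin A t"
  have B: "is_subring ?B" "A \<subseteq> ?B" "t \<in> ?B" using adjoin_subring[OF A] by auto
  note clA = polys_over_closed[OF A is_ideal_self[OF A]]
  define P where "P h \<longleftrightarrow> h \<in> polys_over A \<and> poly h t \<noteq> 0 \<and> (\<exists>y\<in>?B. poly h t = x * y)" for h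
  have powB: "lead_coeff h ^ k \<in> ?B" if "h \<in> polys_over A" for h k
    using that B(2) by (intro subring_closed[OF B(1)]) (auto simp: polys_overD)
  obtain f where f: "f \<in> polys_over A" "x = poly f t" using x by (auto simp: adjoin_def)
  \<comment> \<open>Reducing \<open>f\<close> modulo \<open>g\<close> makes the minimal degree below smaller than that of \<open>g\<close>.\<close>
  obtain k q r where kqr: "smult (lead_coeff g ^ k) f = q * g + r"
    "q \<in> polys_over A" "r \<in> polys_over A" "degree r < degree g"
    using pseudo_division[OF A is_ideal_self[OF A] g(1,2) f(1)] by blast
  have "g \<noteq> 0" using g by auto
  have "poly r t = x * lead_coeff g ^ k"
    using arg_cong[OF kqr(1), of "\<lambda>p. poly p t"] f g by (simp add: mult.commute)
  then have Pr: "P r" unfolding P_def using kqr x powB[OF g(1)] \<open>g \<noteq> 0\<close> by auto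
  define h where "h = arg_min degree P"
  have h: "P h" "\<And>h'. P h' \<Longrightarrow> degree h \<le> degree h'"
    unfolding h_def using arg_min_nat_lemma[of P r degree, OF Pr] by auto
  have hr: "degree h < degree g" using h(2)[OF Pr] kqr(4) by simp
  have h1: "h \<in> polys_over A" "poly h t \<noteq> 0" using h(1) by (auto simp: P_def)
  obtain y where y: "y \<in> ?B" "poly h t = x * y" using h(1) by (auto simp: P_def)
  have "degree h = 0"
  proof (rule ccontr)
    assume "degree h \<noteq> 0"
    then have dh: "degree h > 0" by simp
    obtain k q r where kqr: "smult (lead_coeff h ^ k) g = q * h + r"
      "q \<in> polys_over A" "r \<in> polys_over A" "degree r < degree h"
      using pseudo_division[OF A is_ideal_self[OF A] h1(1) dh g(1)] by blast
    have e: "poly r t = x * (- (poly q t * y))"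
      using arg_cong[OF kqr(1), of "\<lambda>p. poly p t"] y g by (simp add: algebra_simps eq_neg_iff_add_eq_0)
    have "- (poly q t * y) \<in> ?B"
      using kqr y by (intro subring_closed[OF B(1)]) (auto simp: adjoin_def)
    then have "poly r t = 0"
      using h(2)[of r] kqr(3,4) e unfolding P_def by fastforce
    then have q0: "poly q t = 0"
      using arg_cong[OF kqr(1), of "\<lambda>p. poly p t"] g h1 by simp
    have hz: "lead_coeff h ^ k \<noteq> 0" using dh by auto
    have qh: "q * h = smult (lead_coeff h ^ k) g - r" using kqr(1) by simp
    have "degree (q * h) = degree g"
    proof -
      have "degree (smult (lead_coeff h ^ k) g + - r) = degree (smult (lead_coeff h ^ k) g)"
        using kqr(4) hr hz by (intro degree_add_eq_left) auto
      then show ?thesis using hz unfolding qh by auto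
    qed
    moreover have "q \<noteq> 0" "h \<noteq> 0" using calculation g(2) by (metis degree_0 mult_zero_left mult_zero_right less_irrefl)+
    ultimately have "degree q + degree h = degree g" by (simp add: degree_mult_eq)
    then show False using min[OF kqr(2) _ q0] \<open>q \<noteq> 0\<close> dh by auto
  qed
  then obtain c where "h = [:c:]" by (metis degree_eq_zeroE)
  then have "x * y \<in> A" "x * y \<noteq> 0"
    using h1 y polys_overD[of h A 0] by auto
  then show ?thesis using that y by blast
qed

text \<open>
  Extension of a residue field of \<open>A\<close> to \<open>A[t]\<close> in which \<open>t\<close> becomes a root of \<open>g\<close>. Modulo \<open>I\<close> the leading
  coefficient of \<open>g\<close> is a unit, so division by \<open>g\<close> reduces every element of \<open>A[t]\<close> to a polynomial in
  \<open>t\<close> of degree less than that of \<open>g\<close>, with coefficients from a finite set; hence the residue field is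
  finite. The hypothesis \<open>uniq\<close> says that such reduced forms are unique in \<open>A[t] / (g(t))\<close>. It keeps the
  ideal generated by \<open>I\<close> and \<open>g(t)\<close> proper: if \<open>1\<close> were in it, then pseudo-division would put a power of
  the leading coefficient of \<open>g\<close> into \<open>I\<close>. The hypothesis holds both for a minimal polynomial of an
  algebraic \<open>t\<close> and for any polynomial at a transcendental \<open>t\<close>.
\<close>

lemma residue_field_extend:
  fixes g :: "'a :: idom poly"
  assumes A: "is_subring A" and I: "finite_residue_field A I"
    and g: "g \<in> polys_over A" "degree g > 0" "lead_coeff g \<notin> I"
    and uniq: "\<And>q r. q \<in> polys_over A \<Longrightarrow> r \<in> polys_over A \<Longrightarrow> degree r < degree g \<Longrightarrow>
                 poly (q * g + r) t = 0 \<Longrightarrow> r = 0"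
  obtains J where "finite_residue_field (adjoin A t) J" "I \<subseteq> J" "poly g t \<in> J"
proof -
  let ?B = "adjoin A t"
  have B: "is_subring ?B" "A \<subseteq> ?B" "t \<in> ?B" using adjoin_subring[OF A] by auto
  have iI: "is_ideal A I" "1 \<notin> I" "inverses_mod A I"
    using I by (auto simp: finite_residue_field_def)
  obtain S where S: "S \<subseteq> A" "finite S" "\<And>x. x \<in> A \<Longrightarrow> \<exists>s\<in>S. x - s \<in> I"
    using I by (auto simp: finite_residue_field_def)
  note clA = polys_over_closed[OF A is_ideal_self[OF A]]
  note clI = polys_over_closed[OF A iI(1)]
  have IA: "polys_over I \<subseteq> polys_over A"
    using iI by (intro polys_over_mono) (auto simp: is_ideal_def)
  define a where "a = lead_coeff g"
  have a: "a \<in> A" using g by (simp add: a_def polys_overD)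
  have apow: "a ^ k \<notin> I" "a ^ k \<in> A" for k
    using residue_field_power[OF A iI(1,3) a iI(2)] g(3) a subring_closed[OF A]
    by (auto simp: a_def)
  define J0 where "J0 = {x. \<exists>i\<in>polys_over I. \<exists>h\<in>polys_over A. x = poly (h * g + i) t}"
  have J0I: "is_ideal ?B J0"
    unfolding is_ideal_def
  proof (intro conjI ballI subsetI)
    fix x assume "x \<in> J0"
    then obtain i h where "i \<in> polys_over I" "h \<in> polys_over A" "x = poly (h * g + i) t"
      unfolding J0_def by blast
    moreover from this have "h * g + i \<in> polys_over A" using IA g by (intro clA) auto
    ultimately show "x \<in> ?B" unfolding adjoin_def by blast
  next
    have "0 = poly (0 * g + 0) t" by simp
    then show "0 \<in> J0" unfolding J0_def using clA(1) clI(1) by blast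
  next
    fix x y assume "x \<in> J0" "y \<in> J0"
    then obtain i h i' h' where *: "i \<in> polys_over I" "h \<in> polys_over A" "x = poly (h * g + i) t"
      "i' \<in> polys_over I" "h' \<in> polys_over A" "y = poly (h' * g + i') t"
      unfolding J0_def by blast
    then have "x - y = poly ((h - h') * g + (i - i')) t" by (simp add: algebra_simps)
    then show "x - y \<in> J0" unfolding J0_def using * clA(2) clI(2) by blast
  next
    fix r x assume "r \<in> ?B" "x \<in> J0"
    then obtain f i h where *: "f \<in> polys_over A" "r = poly f t"
      "i \<in> polys_over I" "h \<in> polys_over A" "x = poly (h * g + i) t"
      unfolding J0_def adjoin_def by blast
    then have "r * x = poly (f * h * g + f * i) t" by (simp add: algebra_simps)
    then show "r * x \<in> J0" unfolding J0_def using * clA(4) clI(4) by blast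
  qed
  have "1 \<notin> J0"
  proof
    assume "1 \<in> J0"
    then obtain i h where ih: "i \<in> polys_over I" "h \<in> polys_over A" "1 = poly (h * g + i) t"
      unfolding J0_def by blast
    from pseudo_division[OF A iI(1) g(1,2) ih(1)] obtain k q r where
      kqr: "smult (a ^ k) i = q * g + r" "q \<in> polys_over A" "r \<in> polys_over I" "degree r < degree g"
      unfolding a_def by blast
    have "poly (smult (a ^ k) i) t = poly (q * g + r) t" using kqr(1) by simp
    moreover have "a ^ k * 1 = a ^ k * poly (h * g + i) t" using ih(3) by simp
    ultimately have "poly ((q + smult (a ^ k) h) * g + (r - [:a ^ k:])) t = 0"
      by (simp add: algebra_simps)
    moreover have "r - [:a ^ k:] \<in> polys_over A" "q + smult (a ^ k) h \<in> polys_over A"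
      using kqr IA apow ih by (auto intro!: clA)
    moreover have "degree (r - [:a ^ k:]) < degree g"
      using kqr(4) g(2) by (intro degree_diff_less) auto
    ultimately have "r - [:a ^ k:] = 0" using uniq by blast
    then have "coeff r 0 = a ^ k" by simp
    then show False using kqr(3) apow polys_overD by metis
  qed
  then obtain J where J: "is_ideal ?B J" "J0 \<subseteq> J" "1 \<notin> J" "inverses_mod ?B J"
    using maximal_ideal_exists[OF B(1) J0I] by blast
  have one: "1 \<in> polys_over A"
    using clA(7)[of 1 0] subring_closed(1)[OF A] by (simp add: monom_0 one_pCons)
  have "poly i t \<in> J" if "i \<in> polys_over I" for i
  proof -
    have "poly i t = poly (0 * g + i) t" by simp
    then show ?thesis using J(2) that clA(1) unfolding J0_def by blast
  qed note IJ' = this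
  have IJ: "I \<subseteq> J"
  proof
    fix i assume "i \<in> I"
    then have "[:i:] \<in> polys_over I" by (intro clI)
    from IJ'[OF this] show "i \<in> J" by simp
  qed
  have gJ: "poly g t \<in> J"
  proof -
    have "poly g t = poly (1 * g + 0) t" by simp
    then show ?thesis using J(2) one clI(1) unfolding J0_def by blast
  qed
  define S' where "S' = (\<lambda>xs. poly (Poly xs) t) ` {xs. set xs \<subseteq> S \<and> length xs = degree g}"
  have "finite S'" unfolding S'_def using finite_lists_length_eq[OF S(2)] by auto
  moreover have "S' \<subseteq> ?B"
  proof -
    have "Poly xs \<in> polys_over A" if "set xs \<subseteq> S" for xs
      using that S(1) by (induction xs) (auto intro: clA)
    then show ?thesis unfolding S'_def adjoin_def by auto
  qed
  moreover have "\<exists>s\<in>S'. y - s \<in> J" if y: "y \<in> ?B" for y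
  proof -
    obtain f where f: "f \<in> polys_over A" "y = poly f t" using y by (auto simp: adjoin_def)
    from pseudo_division[OF A is_ideal_self[OF A] g(1,2) f(1)] obtain k q r where
      kqr: "smult (a ^ k) f = q * g + r" "q \<in> polys_over A" "r \<in> polys_over A" "degree r < degree g"
      unfolding a_def by blast
    obtain b where b: "b \<in> A" "a ^ k * b - 1 \<in> I"
      using apow iI(3) unfolding inverses_mod_def by blast
    obtain rep where rep: "\<And>x. x \<in> A \<Longrightarrow> rep x \<in> S" "\<And>x. x \<in> A \<Longrightarrow> x - rep x \<in> I"
      using S(3) by metis
    define xs where "xs = map (\<lambda>i. rep (b * coeff r i)) [0..<degree g]"
    have cA: "b * coeff r i \<in> A" for i
      using b kqr(3) by (auto intro: subring_closed[OF A] polys_overD)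
    have "smult b r - Poly xs \<in> polys_over I"
    proof -
      have "coeff (smult b r - Poly xs) i \<in> I" for i
        using rep(2)[OF cA] kqr(4) ideal_closed(1)[OF iI(1)]
        by (cases "i < degree g") (auto simp: xs_def coeff_Poly_eq nth_default_def coeff_eq_0)
      then show ?thesis by (simp add: polys_over_def)
    qed
    then have 1: "b * poly r t - poly (Poly xs) t \<in> J" using IJ' by fastforce
    have bB: "b \<in> ?B" "poly q t \<in> ?B" using b B kqr by (auto simp: adjoin_def)
    then have 2: "b * (poly q t * poly g t) \<in> J" using gJ by (intro ideal_closed(6)[OF J(1)])
    have 3: "y * (a ^ k * b - 1) \<in> J" using b IJ y by (intro ideal_closed(6)[OF J(1)]) auto
    have "a ^ k * y = poly q t * poly g t + poly r t" 
      using arg_cong[OF kqr(1), of "\<lambda>p. poly p t"] f by simp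
    from arg_cong[OF this, of "\<lambda>z. b * z"] have "y - poly (Poly xs) t
       = (b * poly r t - poly (Poly xs) t) + b * (poly q t * poly g t) - y * (a ^ k * b - 1)"
      by (simp add: algebra_simps)
    also have "\<dots> \<in> J" by (rule ideal_closed(3)[OF J(1) ideal_closed(4)[OF J(1) 1 2] 3])
    finally have "y - poly (Poly xs) t \<in> J" .
    moreover have "xs \<in> {xs. set xs \<subseteq> S \<and> length xs = degree g}"
      using rep(1)[OF cA] by (auto simp: xs_def)
    then have "poly (Poly xs) t \<in> S'"
      unfolding S'_def by blast
    ultimately show ?thesis by blast
  qed
  ultimately have "finite_residue_field ?B J"
    using J unfolding finite_residue_field_def by blast
  then show ?thesis using that IJ gJ by blast
qed

section \<open>Finitely generated rings have enough finite residue fields\<close>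

text \<open>
  As the residue rings are fields, an element outside \<open>I\<close> is even a unit modulo \<open>I\<close>; this lets the property
  pass from \<open>A\<close> to \<open>A[t]\<close>.
\<close>

definition residually_finite :: "'a :: comm_ring_1 set \<Rightarrow> bool" where
  "residually_finite R \<longleftrightarrow> (\<forall>x\<in>R. x \<noteq> 0 \<longrightarrow> (\<exists>I. finite_residue_field R I \<and> x \<notin> I))"

text \<open>
  A nonzero \<open>x\<close> in \<open>A[t]\<close> has to survive in a finite residue field. If \<open>t\<close> is algebraic with minimal
  polynomial \<open>g\<close>, then \<open>x\<close> divides a nonzero element of \<open>A\<close>, and it suffices that this element and the
  leading coefficient of \<open>g\<close> survive in a residue field of \<open>A\<close>. If \<open>t\<close> is transcendental and \<open>x = f(t)\<close>,
  Euclid's trick applies: in a residue field of \<open>A[t]\<close> where \<open>1 + t * f(t)\<close> vanishes, \<open>f(t)\<close> cannot vanish.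
\<close>

lemma residually_finite_adjoin:
  fixes t :: "'a :: idom"
  assumes A: "is_subring A" "residually_finite A"
  shows "residually_finite (adjoin A t)"
  unfolding residually_finite_def
proof (intro ballI impI)
  let ?B = "adjoin A t"
  have B: "is_subring ?B" "A \<subseteq> ?B" "t \<in> ?B" using adjoin_subring[OF A(1)] by auto
  note clA = polys_over_closed[OF A(1) is_ideal_self[OF A(1)]]
  fix x assume x: "x \<in> ?B" "x \<noteq> 0"
  show "\<exists>J. finite_residue_field ?B J \<and> x \<notin> J"
  proof (cases "\<exists>h\<in>polys_over A. h \<noteq> 0 \<and> poly h t = 0")
    case True
    then obtain g where g1: "g \<in> polys_over A" and dg: "degree g > 0" and gt: "poly g t = 0"
      and min: "\<And>r. r \<in> polys_over A \<Longrightarrow> degree r < degree g \<Longrightarrow> poly r t = 0 \<Longrightarrow> r = 0"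
      using minimal_polynomial[OF A(1)] by metis
    have g0: "g \<noteq> 0" using dg by auto
    obtain y where y: "y \<in> ?B" "x * y \<in> A" "x * y \<noteq> 0"
      using algebraic_divides_base[OF A(1) g1 dg gt min x] by blast
    have aA: "lead_coeff g \<in> A" using g1 by (simp add: polys_overD)
    have "lead_coeff g * (x * y) \<in> A" "lead_coeff g * (x * y) \<noteq> 0"
      using y g0 aA by (auto intro: subring_closed[OF A(1)])
    then obtain I where I: "finite_residue_field A I" "lead_coeff g * (x * y) \<notin> I"
      using A(2) unfolding residually_finite_def by blast
    then have iI: "is_ideal A I" "inverses_mod A I" by (auto simp: finite_residue_field_def)
    have ni: "lead_coeff g \<notin> I" "x * y \<notin> I"
      using I(2) aA y ideal_closed(6,7)[OF iI(1)] by blast+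
    have "r = 0" if "q \<in> polys_over A" "r \<in> polys_over A" "degree r < degree g" "poly (q * g + r) t = 0"
      for q r using min[of r] that gt by simp
    then obtain J where J: "finite_residue_field ?B J" "I \<subseteq> J"
      using residue_field_extend[OF A(1) I(1) g1 dg ni(1)] by metis
    have jJ: "is_ideal ?B J" "1 \<notin> J" using J by (auto simp: finite_residue_field_def)
    obtain c where c: "c \<in> A" "x * y * c - 1 \<in> I"
      using iI(2) y ni unfolding inverses_mod_def by blast
    have "x \<notin> J"
    proof
      assume "x \<in> J"
      then have "x * (y * c) - (x * y * c - 1) \<in> J"
        using c y B J(2) ideal_closed(3,7)[OF jJ(1)] subring_closed(4)[OF B(1)] by blast
      then show False using jJ(2) by (simp add: mult.assoc)
    qed
    then show ?thesis using J by blast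
  next
    case False
    then have tr: "g = 0" if "g \<in> polys_over A" "poly g t = 0" for g
      using that by blast
    obtain f where f: "f \<in> polys_over A" "x = poly f t" using x by (auto simp: adjoin_def)
    \<comment> \<open>The coefficients of \<open>1 + t * f(t)\<close>; its leading coefficient is that of \<open>f\<close>.\<close>
    define g where "g = pCons 1 f"
    have "f \<noteq> 0" using x f by auto
    then have lg: "lead_coeff g = lead_coeff f" "degree g > 0" by (auto simp: g_def)
    have gA: "g \<in> polys_over A" unfolding g_def using f subring_closed(1)[OF A(1)] by (intro clA)
    have "lead_coeff f \<in> A" "lead_coeff f \<noteq> 0" using f \<open>f \<noteq> 0\<close> by (auto simp: polys_overD)
    then obtain I where I: "finite_residue_field A I" "lead_coeff g \<notin> I"
      using A(2) unfolding residually_finite_def lg(1) by blast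
    have "r = 0" if "q \<in> polys_over A" "r \<in> polys_over A" "degree r < degree g" "poly (q * g + r) t = 0"
      for q r
    proof -
      have "q * g + r \<in> polys_over A" using that gA by (intro clA)
      then have e: "q * g + r = 0" using tr that by blast
      have "q = 0"
      proof (rule ccontr)
        assume "q \<noteq> 0"
        then have "degree (q * g) \<ge> degree g" using lg by (subst degree_mult_eq) auto
        moreover have "r = - (q * g)" using e by (simp add: eq_neg_iff_add_eq_0 add.commute)
        ultimately show False using that by simp
      qed
      then show ?thesis using e by simp
    qed
    then obtain J where J: "finite_residue_field ?B J" "poly g t \<in> J"
      using residue_field_extend[OF A(1) I(1) gA lg(2) I(2)] by metis
    have jJ: "is_ideal ?B J" "1 \<notin> J" using J by (auto simp: finite_residue_field_def)
    have "x \<notin> J"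
    proof
      assume "x \<in> J"
      then have "poly g t - t * x \<in> J"
        using J(2) B ideal_closed(3,6)[OF jJ(1)] by blast
      then show False using jJ(2) by (simp add: g_def f)
    qed
    then show ?thesis using J by blast
  qed
qed

lemma Ints_subring: "is_subring (\<int> :: 'a :: {comm_ring_1} set)"
  by (simp add: is_subring_def)

definition multiples :: "nat \<Rightarrow> 'a :: {comm_ring_1} set" where
  "multiples p = of_int ` {z. int p dvd z}"

lemma is_ideal_multiples: "is_ideal \<int> (multiples p)"
  unfolding is_ideal_def
proof (intro conjI ballI)
  show "0 \<in> multiples p" unfolding multiples_def by (rule image_eqI[of _ _ 0]) auto
  show "x - y \<in> multiples p" if "x \<in> multiples p" "y \<in> multiples p" for x y :: 'a
    using that by (auto simp: multiples_def simp flip: of_int_diff)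
  show "r * x \<in> multiples p" if "r \<in> \<int>" "x \<in> multiples p" for r x :: 'a
    using that by (auto simp: multiples_def elim!: Ints_cases simp flip: of_int_mult)
qed (auto simp: multiples_def)

lemma of_int_mem_multiples_iff:
  "(of_int z :: 'a :: {comm_ring_1, ring_char_0}) \<in> multiples p \<longleftrightarrow> int p dvd z"
  by (auto simp: multiples_def)

lemma residually_finite_Ints:
  "residually_finite (\<int> :: 'a :: {idom, ring_char_0} set)"
  unfolding residually_finite_def
proof (intro ballI impI)
  fix x :: 'a assume "x \<in> \<int>" "x \<noteq> 0"
  then obtain k :: int where k: "x = of_int k" "k \<noteq> 0" by (auto elim: Ints_cases)
  obtain p where p: "prime p" "p > nat \<bar>k\<bar>" using bigger_prime by blast
  let ?I = "multiples p :: 'a set"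
  note mem = of_int_mem_multiples_iff[where 'a = 'a and p = p]
  have "1 \<notin> ?I" using mem[of 1] p prime_gt_1_nat by fastforce
  moreover have "inverses_mod \<int> ?I"
    unfolding inverses_mod_def
  proof
    fix a :: 'a assume "a \<in> \<int> - ?I"
    then obtain z where z: "a = of_int z" "\<not> int p dvd z" using mem by (auto elim: Ints_cases)
    then have "coprime z (int p)"
      using p by (metis coprime_commute prime_imp_coprime prime_int_nat_transfer prime_nat_int_transfer)
    then obtain w where "[z * w = 1] (mod int p)" using cong_solve_coprime_int by blast
    then have "of_int (z * w - 1) \<in> ?I" by (simp add: mem cong_iff_dvd_diff del: of_int_diff of_int_mult)
    then have "a * of_int w - 1 \<in> ?I" using z by simp
    then show "\<exists>b\<in>\<int>. a * b - 1 \<in> ?I" using Ints_of_int by blast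
  qed
  moreover have "\<exists>S\<subseteq>\<int>. finite S \<and> (\<forall>x\<in>\<int>. \<exists>s\<in>S. x - s \<in> ?I)"
  proof (intro exI[of _ "of_int ` {0..<int p}"] conjI ballI)
    fix y :: 'a assume "y \<in> \<int>"
    then obtain z where "y = of_int z" by (auto elim: Ints_cases)
    then have "y - of_int (z mod int p) \<in> ?I" using mem[of "z - z mod int p"] by simp
    moreover have "z mod int p \<in> {0..<int p}" using p prime_gt_0_nat by auto
    ultimately show "\<exists>s\<in>of_int ` {0..<int p}. y - s \<in> ?I" by blast
  qed auto
  moreover have "x \<notin> ?I"
    unfolding k mem using k(2) p(2) zdvd_imp_le[of "int p" "\<bar>k\<bar>"] by auto
  ultimately show "\<exists>I. finite_residue_field \<int> I \<and> x \<notin> I"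
    unfolding finite_residue_field_def using is_ideal_multiples by blast
qed

lemma finitely_generated_residually_finite:
  fixes X :: "'a :: {idom, ring_char_0} set"
  assumes "finite X"
  obtains R where "is_subring R" "X \<subseteq> R" "residually_finite R"
proof -
  have "\<exists>R. is_subring R \<and> X \<subseteq> R \<and> residually_finite R"
    using assms
  proof (induction X)
    case empty
    then show ?case
      using Ints_subring residually_finite_Ints by blast
  next
    case (insert t X)
    then obtain R where "is_subring R" "X \<subseteq> R" "residually_finite R" by blast
    then show ?case
      using adjoin_subring[of R t] residually_finite_adjoin[of R t] by blast
  qed
  then show ?thesis using that by blast
qed

section \<open>Primes congruent to 1\<close>

text \<open>
  Schur's argument. With \<open>c\<close> the constant coefficient, \<open>f(c * C * y) = c * w(y)\<close> for a nonconstant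
  integer polynomial \<open>w\<close> with all values congruent to \<open>1\<close> modulo \<open>C\<close>. Some value of \<open>w\<close> is different
  from \<open>0\<close>, \<open>1\<close> and \<open>-1\<close>, and its prime factors do not divide \<open>C\<close>.
\<close>

lemma prime_dividing_polynomial_value:
  fixes f :: "int poly"
  assumes f: "degree f > 0" "coeff f 0 \<noteq> 0" and C: "C \<noteq> 0"
  obtains p :: nat and x :: int where "prime p" "int p dvd poly f x" "\<not> int p dvd C"
proof -
  define c where "c = coeff f 0"
  obtain f' where f': "f = pCons c f'" "f' \<noteq> 0"
    using f(1) by (cases f) (auto simp: c_def split: if_splits)
  define w where "w = pCons 1 (smult C (pcompose f' [:0, c * C:]))"
  have "pcompose f' [:0, c * C:] \<noteq> 0"
    using f' f(2) C by (simp add: pcompose_eq_0_iff c_def)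
  then have "w - [:k:] \<noteq> 0" for k using C by (simp add: w_def)
  then have "finite {y. poly (w - [:k:]) y = 0}" for k by (rule poly_roots_finite)
  then have "finite ({y. poly (w - [:0:]) y = 0} \<union> {y. poly (w - [:1:]) y = 0} \<union> {y. poly (w - [:-1:]) y = 0})"
    by blast
  from ex_new_if_finite[OF infinite_UNIV_int this] obtain y
    where y: "poly w y \<noteq> 0" "poly w y \<noteq> 1" "poly w y \<noteq> -1" by auto
  then have "\<bar>poly w y\<bar> \<noteq> 1" by auto
  with y(1) obtain p where p: "prime p" "p dvd poly w y"
    by (metis prime_factor_int)
  have *: "poly f (c * C * y) = c * poly w y"
    by (simp add: f'(1) w_def poly_pcompose algebra_simps)
  have "\<not> p dvd C"
  proof
    assume "p dvd C"
    then have "p dvd poly w y - C * (y * poly f' (c * C * y))" using p by auto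
    then have "p dvd 1" by (simp add: w_def poly_pcompose algebra_simps)
    then show False using p(1) not_prime_unit by blast
  qed
  moreover obtain q where "p = int q" "prime q"
    using p(1) by (metis prime_int_nat_transfer prime_ge_0_int int_nat_eq)
  ultimately show ?thesis using that p * by (metis dvd_mult)
qed

lemma poly_map_poly_of_int:
  "poly (map_poly of_int f) (of_int x :: 'a :: {comm_ring_1, ring_char_0}) = of_int (poly f x)"
  by (induction f) (auto simp: map_poly_pCons)

lemma primitive_root_of_unity:
  assumes "T > 0"
  obtains w :: complex where "w ^ T = 1" "\<And>d. 0 < d \<Longrightarrow> d < T \<Longrightarrow> w ^ d \<noteq> 1"
proof -
  define w where "w = cis (2 * pi / T)"
  have pow: "w ^ d = cis (2 * pi * real d / real T)" for d
    by (simp add: w_def DeMoivre field_simps)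
  have "w ^ d \<noteq> 1" if d: "0 < d" "d < T" for d
  proof
    assume "w ^ d = 1"
    then have "cis (2 * pi * real d / real T) = cis (2 * pi * real 0 / real T)" by (simp add: pow)
    then have "d = 0"
      by (rule inj_onD[OF bij_betw_imp_inj_on[OF bij_betw_roots_unity[OF assms]]]) (use d in auto)
    then show False using d by simp
  qed
  moreover have "w ^ T = 1" using assms by (simp add: pow)
  ultimately show ?thesis using that by blast
qed

text \<open>
  Let \<open>w\<close> be a primitive \<open>T\<close>-th root of unity with minimal polynomial \<open>g\<close> over the integers. Up to
  constants, \<open>g\<close> divides \<open>x\<^sup>T - 1\<close>, and for \<open>0 < d < T\<close> some combination of \<open>g\<close> and \<open>x\<^sup>d - 1\<close> is a nonzero
  constant \<open>M d\<close>. A prime \<open>p\<close> that divides a value \<open>g(x)\<close> but none of these constants therefore divides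
  \<open>x\<^sup>T - 1\<close> and no \<open>x\<^sup>d - 1\<close>: the order of \<open>x\<close> modulo \<open>p\<close> is exactly \<open>T\<close>, and it divides \<open>p - 1\<close> by
  Fermat's little theorem.
\<close>

lemma prime_cong_1_exists:
  fixes T N :: nat
  assumes T: "T > 0"
  obtains p where "prime p" "p > N" "[p = 1] (mod T)"
proof -
  obtain w :: complex where w: "w ^ T = 1" "\<And>d. 0 < d \<Longrightarrow> d < T \<Longrightarrow> w ^ d \<noteq> 1"
    using primitive_root_of_unity[OF T] by blast
  let ?Z = "\<int> :: complex set"
  define X where "X d = monom 1 d - (1 :: complex poly)" for d
  have X: "X d \<in> polys_over ?Z" "poly (X d) y = y ^ d - 1" for d y
    by (auto simp: X_def polys_over_def poly_monom)
  have "coeff (X T) T = 1" using T by (simp add: X_def)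
  then have "X T \<noteq> 0" by auto
  have XT0: "poly (X T) w = 0" using X(2) w(1) by simp
  obtain g where g: "g \<in> polys_over ?Z" "degree g > 0" "poly g w = 0"
    "\<And>r. r \<in> polys_over ?Z \<Longrightarrow> degree r < degree g \<Longrightarrow> poly r w = 0 \<Longrightarrow> r = 0"
    using minimal_polynomial[OF Ints_subring X(1) \<open>X T \<noteq> 0\<close> XT0] by blast
  obtain cT qT where cT: "cT \<in> ?Z" "cT \<noteq> 0" "qT \<in> polys_over ?Z" "smult cT (X T) = qT * g"
    using minimal_polynomial_divides[OF Ints_subring g X(1) XT0] by blast
  have "\<exists>M::int. M \<noteq> 0 \<and> (\<forall>I x. is_ideal ?Z I \<longrightarrow> x \<in> ?Z \<longrightarrow> poly g x \<in> I \<longrightarrow> x ^ d - 1 \<in> I \<longrightarrow> of_int M \<in> I)"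
    if d: "d \<in> {1..<T}" for d
  proof -
    have "poly (X d) w \<in> adjoin ?Z w" "poly (X d) w \<noteq> 0"
      using imageI[OF X(1)[of d], of "\<lambda>f. poly f w"] X(2) w(2)[of d] d
      unfolding adjoin_def by (simp_all del: One_nat_def)
    then obtain y where y: "y \<in> adjoin ?Z w" "poly (X d) w * y \<in> ?Z" "poly (X d) w * y \<noteq> 0"
      using algebraic_divides_base[OF Ints_subring g] by blast
    then obtain v where v: "v \<in> polys_over ?Z" "y = poly v w" by (auto simp: adjoin_def)
    define m where "m = poly (X d) w * y"
    have "X d * v - [:m:] \<in> polys_over ?Z"
      using X v y polys_over_closed[OF Ints_subring is_ideal_self[OF Ints_subring]]
      unfolding m_def by (metis monom_0)
    moreover have "poly (X d * v - [:m:]) w = 0" by (simp add: m_def v)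
    ultimately obtain c q where c: "c \<in> ?Z" "c \<noteq> 0" "q \<in> polys_over ?Z"
      "smult c (X d * v - [:m:]) = q * g"
      using minimal_polynomial_divides[OF Ints_subring g] by blast
    have "c * m \<in> ?Z" using c y by (simp add: m_def)
    then obtain M where M: "c * m = of_int M" by (auto elim: Ints_cases)
    have "of_int M \<in> I" if I: "is_ideal ?Z I" and x: "x \<in> ?Z" "poly g x \<in> I" "x ^ d - 1 \<in> I" for I x
    proof -
      have "c * ((x ^ d - 1) * poly v x - m) = poly q x * poly g x"
        using arg_cong[OF c(4), of "\<lambda>p. poly p x"] X(2) by simp
      then have "of_int M = (c * poly v x) * (x ^ d - 1) - poly q x * poly g x"
        unfolding M[symmetric] by (simp add: algebra_simps)
      also have "\<dots> \<in> I"
        using c v x poly_mem_ideal[OF Ints_subring]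
        by (intro ideal_closed(3,6)[OF I] Ints_mult ideal_closed(6)[OF I] x) auto
      finally show ?thesis .
    qed
    moreover have "M \<noteq> 0" using M c y by (auto simp: m_def)
    ultimately show ?thesis by blast
  qed
  then obtain M where M: "\<And>d. d \<in> {1..<T} \<Longrightarrow> M d \<noteq> (0::int)"
     "\<And>d I x. d \<in> {1..<T} \<Longrightarrow> is_ideal ?Z I \<Longrightarrow> x \<in> ?Z \<Longrightarrow> poly g x \<in> I \<Longrightarrow> x ^ d - 1 \<in> I \<Longrightarrow> of_int (M d) \<in> I"
    by metis
  obtain c where c: "cT = of_int c" using cT(1) by (auto elim: Ints_cases)
  obtain f where f: "g = map_poly of_int f"
    using intpolyE[of g] g(1) by (auto simp: polys_over_def)
  have dg: "degree f > 0" using g(2) by (simp add: f degree_map_poly)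
  have "poly g 0 \<noteq> 0"
  proof
    assume "poly g 0 = 0"
    then show False using arg_cong[OF cT(4), of "\<lambda>p. poly p 0"] X(2) cT(2) T by (simp add: zero_power)
  qed
  then have f0: "coeff f 0 \<noteq> 0" by (simp add: f poly_0_coeff_0 coeff_map_poly)
  \<comment> \<open>The factor \<open>fact N\<close> forces the prime to exceed \<open>N\<close>.\<close>
  define C where "C = c * fact N * (\<Prod>d\<in>{1..<T}. M d)"
  have "C \<noteq> 0" using c cT M by (auto simp: C_def)
  then obtain p x where p: "prime p" "int p dvd poly f x" "\<not> int p dvd C"
    using prime_dividing_polynomial_value[OF dg f0] by blast
  let ?I = "multiples p :: complex set"
  have I: "is_ideal ?Z ?I" by (rule is_ideal_multiples)
  have gx: "poly g (of_int x) \<in> ?I"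
    unfolding f poly_map_poly_of_int of_int_mem_multiples_iff by (rule p)
  have "poly qT (of_int x) * poly g (of_int x) \<in> ?I"
    by (intro ideal_closed(6)[OF I] gx poly_mem_ideal[OF Ints_subring cT(3)] Ints_of_int)
  also have "poly qT (of_int x) * poly g (of_int x) = of_int (c * (x ^ T - 1))"
    using arg_cong[OF cT(4), of "\<lambda>p. poly p (of_int x)"] X(2) c by simp
  finally have "int p dvd c * (x ^ T - 1)" unfolding of_int_mem_multiples_iff .
  moreover have "\<not> int p dvd c" using p(3) by (auto simp: C_def)
  ultimately have "int p dvd x ^ T - 1" using p(1)
    by (simp add: prime_dvd_mult_iff)
  then have xT: "[x ^ T = 1] (mod int p)" by (simp add: cong_iff_dvd_diff)
  have ord: "\<not> [x ^ d = 1] (mod int p)" if d: "d \<in> {1..<T}" for d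
  proof
    assume "[x ^ d = 1] (mod int p)"
    then have "of_int (x ^ d - 1) \<in> ?I" by (simp only: of_int_mem_multiples_iff cong_iff_dvd_diff)
    then have "of_int (M d) \<in> ?I" using M(2)[OF d I _ gx] by simp
    then have "int p dvd M d" by (simp only: of_int_mem_multiples_iff)
    then have "int p dvd C" unfolding C_def using d by (metis dvd_mult dvd_prodI dvd_trans finite_atLeastLessThan)
    then show False using p by blast
  qed
  have "\<not> p \<le> N"
  proof
    assume "p \<le> N"
    then have "p dvd fact N" using p(1) by (simp add: prime_dvd_fact_iff)
    then have "int p dvd fact N" by (metis of_nat_fact of_nat_dvd_iff)
    then show False using p(3) by (auto simp: C_def)
  qed
  have "\<not> int p dvd x"
  proof
    assume "int p dvd x"
    then have "int p dvd x ^ T" using T by (meson dvd_power dvd_trans)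
    then have "int p dvd 1" using xT by (metis cong_dvd_iff)
    then show False using p(1) by simp
  qed
  define r where "r = (p - 1) mod T"
  have "coprime x (int p)"
    using \<open>\<not> int p dvd x\<close> p(1) by (metis coprime_commute prime_imp_coprime prime_nat_int_transfer)
  then have "coprime (nat (x mod int p)) p"
    using p(1) prime_gt_0_nat[of p]
    by (metis coprime_int_iff coprime_mod_left_iff gr_implies_not0 int_nat_eq of_nat_eq_0_iff of_nat_0_less_iff pos_mod_sign)
  then have "\<not> p dvd nat (x mod int p)"
    using p(1) by (metis coprime_absorb_right not_prime_unit)
  from fermat_theorem[OF p(1) this] have "[(x mod int p) ^ (p - 1) = 1] (mod int p)"
    using p(1) prime_gt_0_nat[of p] by (simp flip: cong_int_iff)
  then have xp: "[x ^ (p - 1) = 1] (mod int p)" by (simp add: cong_def power_mod)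
  have "x ^ (p - 1) = (x ^ T) ^ ((p - 1) div T) * x ^ r"
    by (simp add: r_def flip: power_mult power_add)
  also have "[\<dots> = 1 ^ ((p - 1) div T) * x ^ r] (mod int p)"
    by (intro cong_mult cong_pow xT cong_refl)
  finally have "[x ^ r = 1] (mod int p)" using xp by (metis cong_sym cong_trans mult_1 power_one)
  moreover have "r < T" using T by (simp add: r_def)
  ultimately have "r = 0" using ord[of r] by (cases "r = 0") auto
  then have "T dvd p - 1" by (auto simp: r_def)
  then have "[p = 1] (mod T)"
    using p(1) prime_gt_0_nat[of p] by (metis cong_altdef_nat cong_sym Suc_leI One_nat_def)
  then show ?thesis using that p(1) \<open>\<not> p \<le> N\<close> by auto
qed

section \<open>Divisor sums of periodic sequences\<close>

lemma divisors_mult_prime_square: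
  fixes d p :: nat
  assumes p: "prime p" "\<not> p dvd d"
  shows "{e. e dvd d * p ^ 2} = {e. e dvd d * p} \<union> (\<lambda>e. e * p ^ 2) ` {e. e dvd d}"
    and "{e. e dvd d * p} \<inter> (\<lambda>e. e * p ^ 2) ` {e. e dvd d} = {}"
proof -
  have p0: "p > 0" using p prime_gt_0_nat by simp
  have "e dvd d * p \<or> e \<in> (\<lambda>e. e * p ^ 2) ` {e. e dvd d}" if e: "e dvd d * p ^ 2" for e
  proof (cases "p dvd e")
    case False
    from prime_imp_coprime[OF p(1) this] have "coprime e (p ^ 2)" by (simp add: coprime_commute)
    then show ?thesis using e by (simp add: coprime_dvd_mult_left_iff)
  next
    case True
    then obtain f where f: "e = p * f" by blast
    then have fd: "f dvd d * p" using e p0 by (simp add: power2_eq_square algebra_simps)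
    show ?thesis
    proof (cases "p dvd f")
      case True
      then obtain h where "f = p * h" by blast
      then show ?thesis using f fd p0
        by (intro disjI2 image_eqI[of _ _ h]) (auto simp: power2_eq_square algebra_simps)
    next
      case False
      from prime_imp_coprime[OF p(1) this] have "coprime f p" by (simp add: coprime_commute)
      then have "f dvd d" using fd by (simp add: coprime_dvd_mult_left_iff)
      then show ?thesis using f by (simp add: mult.commute mult_dvd_mono)
    qed
  qed
  moreover have "e dvd d * p ^ 2" if "e dvd d * p" for e
    using that by (metis dvd_mult2 mult.assoc power2_eq_square)
  ultimately show "{e. e dvd d * p ^ 2} = {e. e dvd d * p} \<union> (\<lambda>e. e * p ^ 2) ` {e. e dvd d}"
    by auto
  show "{e. e dvd d * p} \<inter> (\<lambda>e. e * p ^ 2) ` {e. e dvd d} = {}"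
  proof (intro equals0I)
    fix x assume "x \<in> {e. e dvd d * p} \<inter> (\<lambda>e. e * p ^ 2) ` {e. e dvd d}"
    then obtain e where "e * p ^ 2 dvd d * p" by auto
    then have "e * p dvd d" using p0 by (simp add: power2_eq_square flip: mult.assoc)
    then show False using p(2) dvd_mult_right by blast
  qed
qed

lemma periodic_add_mult:
  fixes u :: "nat \<Rightarrow> 'a :: comm_ring_1"
  assumes I: "is_ideal R I" and per: "\<And>n. n \<ge> m \<Longrightarrow> u (n + P) - u n \<in> I" and "n \<ge> m"
  shows "u (n + k * P) - u n \<in> I"
proof (induction k)
  case (Suc k)
  have "(u (n + k * P + P) - u (n + k * P)) + (u (n + k * P) - u n) \<in> I"
    using Suc per[of "n + k * P"] assms(3) by (intro ideal_closed(4)[OF I]) auto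
  then show ?case by (simp add: algebra_simps)
qed (use ideal_closed(1)[OF I] in simp)

lemma periodic_cong:
  fixes u :: "nat \<Rightarrow> 'a :: comm_ring_1"
  assumes I: "is_ideal R I" and per: "\<And>n. n \<ge> m \<Longrightarrow> u (n + P) - u n \<in> I"
    and "n \<ge> m" "n' \<ge> m" "[n = n'] (mod P)"
  shows "u n - u n' \<in> I"
proof -
  have *: "u n - u n' \<in> I" if nn: "n' \<ge> m" "n \<ge> n'" "[n = n'] (mod P)" for n n'
  proof -
    obtain k where "n = n' + k * P"
      using nn(2,3) by (auto simp: cong_le_nat add.commute)
    then show ?thesis using periodic_add_mult[where u = u, OF I per nn(1)] by simp
  qed
  show ?thesis
  proof (cases "n \<ge> n'")
    case False
    then have "- (u n' - u n) \<in> I" using assms by (intro ideal_closed(5)[OF I] *) (auto simp: cong_sym)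
    then show ?thesis by simp
  qed (use * assms in auto)
qed

text \<open>
  A periodic analogue of the theorem, over an arbitrary ring modulo an ideal. The auxiliary sequence \<open>w\<close>
  is the periodic continuation of \<open>u\<close> to small indices; its divisor sums are differences of values of
  \<open>a\<close> at two arguments that are congruent modulo \<open>P\<close>.
\<close>

lemma periodic_divisor_sum_vanishes:
  fixes u a :: "nat \<Rightarrow> 'a :: comm_ring_1"
  assumes I: "is_ideal R I" and P: "P > 0"
    and u: "\<And>n. n \<ge> m \<Longrightarrow> u (n + P) - u n \<in> I"
    and a: "\<And>n. n \<ge> m' \<Longrightarrow> a (n + P) - a n \<in> I"
    and conv: "\<And>n. n > 0 \<Longrightarrow> a n = (\<Sum>d | d dvd n. u d)"
    and n: "n \<ge> m" "n > 0"
  shows "u n \<in> I"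
proof -
  \<comment> \<open>Adding \<open>m * P\<close> moves any index past \<open>m\<close> within its residue class.\<close>
  define w where "w e = u (e + m * P)" for e
  have w: "u k - w e \<in> I" if "k \<ge> m" "[k = e] (mod P)" for k e
    unfolding w_def using that P mult_le_mono2[of 1 P m] trans_le_add2[of m "m * P" e]
    by (intro periodic_cong[where u = u, OF I u]) (auto simp: cong_def)
  have sum_w: "(\<Sum>e | e dvd d. w e) \<in> I" if d: "d > 0" for d
  proof -
    obtain p where p: "prime p" "p > m + m' + d" "[p = 1] (mod P)"
      using prime_cong_1_exists[OF P] by blast
    have nd: "\<not> p dvd d" using p(2) d by (auto dest: dvd_imp_le)
    have p1: "p \<ge> 1" and big: "x * p \<ge> p" "x * p ^ 2 \<ge> p" if "x > 0" for x
      using that p(1) prime_gt_0_nat[of p] by (auto simp: power2_eq_square)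
    have pc: "[x * p = x] (mod P)" "[x * p ^ 2 = x] (mod P)" for x
      using cong_mult[OF cong_refl[of x] p(3)] cong_mult[OF cong_refl[of x] cong_pow[OF p(3), of 2]]
      by auto
    have "a (d * p ^ 2) = (\<Sum>e | e dvd d * p. u e) + (\<Sum>e\<in>(\<lambda>e. e * p ^ 2) ` {e. e dvd d}. u e)"
      using d p nd prime_gt_0_nat[OF p(1)]
      by (subst conv) (auto simp: divisors_mult_prime_square(1)[OF p(1) nd]
        intro!: sum.union_disjoint divisors_mult_prime_square(2))
    also have "(\<Sum>e | e dvd d * p. u e) = a (d * p)"
      using d prime_gt_0_nat[OF p(1)] by (simp add: conv)
    also have "(\<Sum>e\<in>(\<lambda>e. e * p ^ 2) ` {e. e dvd d}. u e) = (\<Sum>e | e dvd d. u (e * p ^ 2))"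
      using prime_gt_0_nat[OF p(1)] by (subst sum.reindex) (auto simp: inj_on_def)
    finally have 1: "(\<Sum>e | e dvd d. u (e * p ^ 2)) = a (d * p ^ 2) - a (d * p)" by simp
    have "a (d * p ^ 2) - a (d * p) \<in> I"
      using big[OF d] p(2) pc[of d] by (intro periodic_cong[where u = a, OF I a]) (auto simp: cong_def)
    moreover have "(\<Sum>e | e dvd d. u (e * p ^ 2) - w e) \<in> I"
    proof (intro ideal_sum[OF I] w pc)
      fix e assume "e \<in> {e. e dvd d}"
      then have "e > 0" using d by (auto intro: Nat.gr0I)
      then show "e * p ^ 2 \<ge> m" using big(2)[of e] p(2) by simp
    qed
    ultimately have "(a (d * p ^ 2) - a (d * p)) - (\<Sum>e | e dvd d. u (e * p ^ 2) - w e) \<in> I"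
      by (rule ideal_closed(3)[OF I])
    then show ?thesis unfolding 1[symmetric] by (simp add: sum_subtractf)
  qed
  have "w d \<in> I" if "d > 0" for d
    using that
  proof (induction d rule: less_induct)
    case (less d)
    have "{e. e dvd d} = insert d {e. e dvd d \<and> e < d}" "finite {e. e dvd d \<and> e < d}"
      using less.prems by (auto dest: dvd_imp_le)
    then have "(\<Sum>e | e dvd d. w e) = w d + (\<Sum>e | e dvd d \<and> e < d. w e)" by simp
    moreover have "(\<Sum>e | e dvd d \<and> e < d. w e) \<in> I"
      using less by (intro ideal_sum[OF I]) (auto intro: Nat.gr0I)
    ultimately show ?case
      using sum_w[OF less.prems] ideal_closed(3)[OF I] by (metis add_diff_cancel_right')
  qed
  then have "(u n - w n) + w n \<in> I" using w[of n n] n by (intro ideal_closed(4)[OF I]) auto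
  then show ?thesis by simp
qed

section \<open>Linear recurrences modulo an ideal\<close>

text \<open>
  The coefficient \<open>c 0\<close> belongs to the oldest term of the window. Where it is invertible the recurrence
  can be run backwards.
\<close>

definition recurrence :: "nat \<Rightarrow> (nat \<Rightarrow> 'a :: comm_ring_1) \<Rightarrow> nat \<Rightarrow> (nat \<Rightarrow> 'a) \<Rightarrow> bool" where
  "recurrence s c m u \<longleftrightarrow> (\<forall>n\<ge>m. u (n + s) = (\<Sum>i<s. c i * u (n + i)))"

lemma recurrence_mem_subring:
  assumes R: "is_subring R" and rec: "recurrence s c m u"
    and c: "\<And>i. i < s \<Longrightarrow> c i \<in> R" and init: "\<And>i. i < m + s \<Longrightarrow> u i \<in> R"
  shows "u n \<in> R"
proof (induction n rule: less_induct)
  case (less n)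
  show ?case
  proof (cases "n < m + s")
    case False
    then have "u n = (\<Sum>i<s. c i * u (n - s + i))"
      using rec[unfolded recurrence_def, rule_format, of "n - s"] by simp
    also have "\<dots> \<in> R"
      using False by (intro subring_sum[OF R] subring_closed(4)[OF R] c less) auto
    finally show ?thesis .
  qed (rule init)
qed

text \<open>
  Pigeonhole principle: the state of the recurrence is the block of the next \<open>s\<close> terms modulo \<open>I\<close>, and only
  finitely many states exist. Once a state repeats, so does everything after it.
\<close>

lemma recurrence_eventually_periodic_mod:
  assumes R: "is_subring R" and I: "finite_residue_field R I" and rec: "recurrence s c m u"
    and c: "\<And>i. i < s \<Longrightarrow> c i \<in> R" and uR: "\<And>n. u n \<in> R"
  obtains P m' where "P > 0" "m' \<ge> m" "\<And>n. n \<ge> m' \<Longrightarrow> u (n + P) - u n \<in> I"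
proof -
  have iI: "is_ideal R I" using I by (simp add: finite_residue_field_def)
  obtain S where S: "finite S" "\<And>x. x \<in> R \<Longrightarrow> \<exists>s\<in>S. x - s \<in> I"
    using I by (auto simp: finite_residue_field_def)
  obtain rep where rep: "\<And>x. x \<in> R \<Longrightarrow> rep x \<in> S" "\<And>x. x \<in> R \<Longrightarrow> x - rep x \<in> I"
    using S(2) by metis
  define state where "state n = (\<lambda>i\<in>{..<s}. rep (u (n + i)))" for n
  have "state ` {m..} \<subseteq> PiE {..<s} (\<lambda>_. S)"
    unfolding state_def using rep(1) uR by (intro image_subsetI) (simp add: restrict_PiE_iff)
  then have "finite (state ` {m..})"
    using S(1) by (meson finite_PiE finite_lessThan finite_subset)
  then have "\<not> inj_on state {m..}" using infinite_Ici[of m] finite_imageD by blast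
  then obtain x y where xy: "x \<ge> m" "x < y" "state x = state y"
    unfolding inj_on_def by (metis atLeast_iff linorder_neqE_nat)
  define P where "P = y - x"
  have eq: "u (x + P + i) - u (x + i) \<in> I" for i
  proof (induction i rule: less_induct)
    case (less i)
    show ?case
    proof (cases "i < s")
      case True
      then have "rep (u (x + i)) = rep (u (x + P + i))"
        using fun_cong[OF xy(3), of i] xy(2) by (simp add: state_def P_def)
      moreover have "(u (x + P + i) - rep (u (x + P + i))) - (u (x + i) - rep (u (x + i))) \<in> I"
        by (intro ideal_closed(3)[OF iI] rep uR)
      ultimately show ?thesis by simp
    next
      case False
      have "u (x + P + i) = (\<Sum>j<s. c j * u (x + P + (i - s) + j))"
        "u (x + i) = (\<Sum>j<s. c j * u (x + (i - s) + j))"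
        using rec[unfolded recurrence_def, rule_format, of "x + P + (i - s)"]
          rec[unfolded recurrence_def, rule_format, of "x + (i - s)"] False xy(1) by simp_all
      then have "u (x + P + i) - u (x + i)
          = (\<Sum>j<s. c j * (u (x + P + (i - s + j)) - u (x + (i - s + j))))"
        by (simp add: right_diff_distrib sum_subtractf add.assoc)
      also have "\<dots> \<in> I"
        using False by (intro ideal_sum[OF iI] ideal_closed(6)[OF iI] c less) auto
      finally show ?thesis .
    qed
  qed
  have "u (n + P) - u n \<in> I" if "n \<ge> x" for n
    using eq[of "n - x"] that by (simp add: algebra_simps)
  moreover have "P > 0" using xy by (simp add: P_def)
  ultimately show ?thesis using that xy(1) by blast
qed

text \<open>
  As \<open>c 0\<close> is a unit modulo \<open>I\<close>, the recurrence determines \<open>u n\<close> from the \<open>s\<close> terms after it, so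
  periodicity spreads back to the start \<open>m\<close> of the recurrence.
\<close>

lemma recurrence_periodic_backwards:
  assumes R: "is_subring R" and I: "finite_residue_field R I" and rec: "recurrence s c m u"
    and c: "\<And>i. i < s \<Longrightarrow> c i \<in> R" "c 0 \<notin> I" and uR: "\<And>n. u n \<in> R"
    and per: "m' \<ge> m" "\<And>n. n \<ge> m' \<Longrightarrow> u (n + P) - u n \<in> I"
    and n: "n \<ge> m"
  shows "u (n + P) - u n \<in> I"
proof (cases "n \<ge> m'")
  case False
  have iI: "is_ideal R I" "inverses_mod R I" using I by (auto simp: finite_residue_field_def)
  define D where "D n = u (n + P) - u n" for n
  have D: "D (k + s) = (\<Sum>i<s. c i * D (k + i))" if "k \<ge> m" for k
    using rec[unfolded recurrence_def, rule_format, of k]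
      rec[unfolded recurrence_def, rule_format, of "k + P"] that
    by (simp add: D_def right_diff_distrib sum_subtractf add_ac)
  from False have "n \<le> m'" by simp
  then have "\<forall>k\<ge>n. D k \<in> I"
    using n
  proof (induction n rule: inc_induct)
    case base
    then show ?case using per(2) by (auto simp: D_def)
  next
    case (step n)
    then have IH: "D k \<in> I" if "k > n" for k using that by auto
    have "D n \<in> I"
    proof (cases "s = 0")
      case True
      then show ?thesis using D[of n] step.prems ideal_closed(1)[OF iI(1)] by simp
    next
      case False
      then obtain s' where s': "s = Suc s'" by (cases s) auto
      have "c 0 * D n = D (n + s) - (\<Sum>i<s'. c (Suc i) * D (n + Suc i))"
        using D[of n] step.prems by (simp add: s' sum.lessThan_Suc_shift del: sum.lessThan_Suc)
      also have "\<dots> \<in> I"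
        using False s' by (intro ideal_closed(3,6)[OF iI(1)] ideal_sum[OF iI(1)] IH c) auto
      finally show ?thesis
        using c(1)[of 0] c(2) uR subring_closed(3)[OF R] False
        by (intro residue_field_mult[OF R iI, of "c 0" "D n"]) (auto simp: D_def)
    qed
    then show ?case using IH by (metis le_neq_implies_less)
  qed
  then show ?thesis by (simp add: D_def)
qed (rule per(2))

text \<open>
  The start \<open>m\<close> of the recurrence does not depend on the ideal. This is why a nonzero \<open>u n\<close> can be fixed
  first and the ideal be chosen afterwards so as to avoid it.
\<close>

lemma recurrent_divisor_sum:
  fixes u a :: "nat \<Rightarrow> 'a :: {idom, ring_char_0}"
  assumes u: "recurrence s c m u" "c 0 \<noteq> 0" and a: "recurrence s' c' m' a"
    and conv: "\<And>n. n > 0 \<Longrightarrow> a n = (\<Sum>d | d dvd n. u d)"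
    and n: "n \<ge> m" "n > 0"
  shows "u n = 0"
proof (rule ccontr)
  assume un: "u n \<noteq> 0"
  define X where "X = insert (c 0) (c ` {..<s} \<union> c' ` {..<s'} \<union> u ` {..<m + s} \<union> a ` {..<m' + s'})"
  have "finite X" by (simp add: X_def)
  then obtain R where R: "is_subring R" "X \<subseteq> R" "residually_finite R"
    using finitely_generated_residually_finite by blast
  then have cR: "c 0 \<in> R" "\<And>i. i < s \<Longrightarrow> c i \<in> R" "\<And>i. i < s' \<Longrightarrow> c' i \<in> R"
    and init: "\<And>i. i < m + s \<Longrightarrow> u i \<in> R" "\<And>i. i < m' + s' \<Longrightarrow> a i \<in> R"
    unfolding X_def by blast+
  have uR: "u k \<in> R" for k
    by (rule recurrence_mem_subring[OF R(1) u(1) cR(2) init(1)])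
  have aR: "a k \<in> R" for k
    by (rule recurrence_mem_subring[OF R(1) a cR(3) init(2)])
  \<comment> \<open>An ideal that avoids this product avoids both factors.\<close>
  have "c 0 * u n \<in> R" "c 0 * u n \<noteq> 0" using u(2) un cR uR subring_closed(4)[OF R(1)] by auto
  then obtain I where I: "finite_residue_field R I" "c 0 * u n \<notin> I"
    using R(3) unfolding residually_finite_def by blast
  have iI: "is_ideal R I" using I by (simp add: finite_residue_field_def)
  have ni: "c 0 \<notin> I" "u n \<notin> I" using I(2) cR uR ideal_closed(6,7)[OF iI] by blast+
  obtain P k where P: "P > 0" "k \<ge> m" "\<And>n. n \<ge> k \<Longrightarrow> u (n + P) - u n \<in> I"
    using recurrence_eventually_periodic_mod[OF R(1) I(1) u(1) cR(2) uR] by blast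
  have Pu: "u (n + P) - u n \<in> I" if "n \<ge> m" for n
    using recurrence_periodic_backwards[OF R(1) I(1) u(1) cR(2) ni(1) uR P(2,3) that] .
  obtain Q k' where Q: "Q > 0" "\<And>n. n \<ge> k' \<Longrightarrow> a (n + Q) - a n \<in> I"
    using recurrence_eventually_periodic_mod[OF R(1) I(1) a cR(3) aR] by blast
  have "u (n + P * Q) - u n \<in> I" if "n \<ge> m" for n
    using periodic_add_mult[where u = u, OF iI Pu that, of Q] by (simp add: mult.commute)
  moreover have "a (n + P * Q) - a n \<in> I" if "n \<ge> k'" for n
    using periodic_add_mult[where u = a, OF iI Q(2) that, of P] .
  ultimately have "u n \<in> I"
    using periodic_divisor_sum_vanishes[OF iI _ _ _ conv n, of "P * Q" k'] P(1) Q(1) by auto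
  then show False using ni by blast
qed

section \<open>Rational power series\<close>

lemma fps_rational_altdef:
  "fps_rational F \<longleftrightarrow> (\<exists>p q. poly q 0 \<noteq> 0 \<and> F * fps_of_poly q = fps_of_poly p)"
proof -
  have "F = fps_of_poly p / fps_of_poly q \<longleftrightarrow> F * fps_of_poly q = fps_of_poly p"
    if "poly q 0 \<noteq> 0" for p q :: "complex poly"
  proof -
    have "fps_of_poly q $ 0 \<noteq> 0" using that by (simp add: poly_0_coeff_0)
    then have q: "fps_of_poly q * inverse (fps_of_poly q) = 1"
      and div: "fps_of_poly p / fps_of_poly q = fps_of_poly p * inverse (fps_of_poly q)"
      by (simp_all add: inverse_mult_eq_1' fps_divide_unit)
    show ?thesis
    proof
      assume "F = fps_of_poly p / fps_of_poly q"
      then show "F * fps_of_poly q = fps_of_poly p"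
        using q by (simp add: div mult.assoc mult.commute[of "inverse _"])
    next
      assume "F * fps_of_poly q = fps_of_poly p"
      then have "fps_of_poly p * inverse (fps_of_poly q) = F" using q by (metis mult.assoc mult.right_neutral)
      then show "F = fps_of_poly p / fps_of_poly q" by (simp add: div)
    qed
  qed
  then show ?thesis unfolding fps_rational_def by blast
qed

text \<open>
  The recurrence compares coefficients in \<open>F * q = p\<close> beyond the degree of \<open>p\<close>. Its order is the degree of
  \<open>q\<close>, so \<open>c 0\<close> is, up to the factor \<open>- 1 / q(0)\<close>, the leading coefficient of \<open>q\<close> and hence nonzero.
\<close>

lemma fps_rational_recurrence:
  assumes "fps_rational F"
  obtains s c m where "c 0 \<noteq> 0" "recurrence s c m (fps_nth F)"
proof -
  obtain p q where pq: "poly q 0 \<noteq> 0" "F * fps_of_poly q = fps_of_poly p"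
    using assms by (auto simp: fps_rational_altdef)
  define s where "s = degree q"
  have q0: "coeff q 0 \<noteq> 0" using pq by (simp add: poly_0_coeff_0)
  define c where "c j = - coeff q (s - j) / coeff q 0" for j
  have "F $ (n + s) = (\<Sum>i<s. c i * F $ (n + i))" if n: "n \<ge> Suc (degree p)" for n
  proof -
    have "(F * fps_of_poly q) $ (n + s) = 0"
      using n by (simp add: pq(2) coeff_eq_0)
    moreover have "(F * fps_of_poly q) $ (n + s) = (\<Sum>i\<in>{n..n + s}. F $ i * coeff q (n + s - i))"
      unfolding fps_mult_nth
      by (intro sum.mono_neutral_cong_right) (auto simp: s_def coeff_eq_0)
    moreover have "\<dots> = (\<Sum>i\<le>s. F $ (n + i) * coeff q (s - i))"
      by (rule sum.reindex_bij_witness[of _ "\<lambda>i. n + i" "\<lambda>i. i - n"])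
        (auto simp: add.commute)
    moreover have "\<dots> = (\<Sum>i<s. F $ (n + i) * coeff q (s - i)) + F $ (n + s) * coeff q 0"
      by (simp add: lessThan_Suc_atMost[symmetric])
    ultimately have "F $ (n + s) * coeff q 0 = - (\<Sum>i<s. F $ (n + i) * coeff q (s - i))"
      by (metis add_eq_0_iff)
    then have "F $ (n + s) = - (\<Sum>i<s. F $ (n + i) * coeff q (s - i)) / coeff q 0"
      using q0 by (simp add: field_simps)
    also have "\<dots> = (\<Sum>i<s. c i * F $ (n + i))"
      by (simp add: c_def sum_divide_distrib sum_negf mult.commute)
    finally show ?thesis .
  qed
  then have "recurrence s c (Suc (degree p)) (fps_nth F)" by (simp add: recurrence_def)
  moreover have "q \<noteq> 0" using q0 by auto
  then have "c 0 \<noteq> 0" using q0 by (simp add: c_def s_def)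
  ultimately show ?thesis using that by blast
qed

lemma fps_rational_add:
  assumes "fps_rational F" "fps_rational G"
  shows "fps_rational (F + G)"
proof -
  obtain p q p' q' where *: "poly q 0 \<noteq> 0" "F * fps_of_poly q = fps_of_poly p"
    "poly q' 0 \<noteq> 0" "G * fps_of_poly q' = fps_of_poly p'"
    using assms by (auto simp: fps_rational_altdef)
  have "(F + G) * fps_of_poly (q * q')
      = (F * fps_of_poly q) * fps_of_poly q' + (G * fps_of_poly q') * fps_of_poly q"
    by (simp add: fps_of_poly_mult algebra_simps)
  also have "\<dots> = fps_of_poly (p * q' + p' * q)"
    by (simp add: * fps_of_poly_mult fps_of_poly_add)
  finally show ?thesis using * unfolding fps_rational_altdef by (metis mult_eq_0_iff poly_mult)
qed

lemma fps_rational_Lambert_summand: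
  assumes "n > 0"
  shows "fps_rational (fps_const c * (fps_X ^ n / (1 - fps_X ^ n)))"
proof -
  have q: "(1 - fps_X ^ n :: complex fps) $ 0 \<noteq> 0" using assms by simp
  have "fps_X ^ n / (1 - fps_X ^ n) * (1 - fps_X ^ n :: complex fps) = fps_X ^ n"
    using q by (simp add: fps_divide_unit mult.assoc inverse_mult_eq_1)
  then have "fps_const c * (fps_X ^ n / (1 - fps_X ^ n)) * fps_of_poly (1 - monom 1 n)
      = fps_of_poly (monom c n)"
    by (simp add: fps_of_poly_diff fps_of_poly_monom mult.assoc)
  moreover have "poly (1 - monom 1 n) (0 :: complex) \<noteq> 0"
    using assms by (simp add: poly_monom zero_power)
  ultimately show ?thesis unfolding fps_rational_altdef by blast
qed

lemma finitely_supported_imp_Lambert_rational: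
  assumes "finitely_supported \<gamma>"
  shows "fps_rational (Lambert_fps \<gamma>)"
proof -
  let ?t = "\<lambda>n. fps_const (\<gamma> (Suc n)) * (fps_X ^ Suc n / (1 - fps_X ^ Suc n)) :: complex fps"
  define N where "N = {n. \<gamma> (Suc n) \<noteq> 0}"
  have "Suc ` N \<subseteq> {n. n \<ge> 1 \<and> \<gamma> n \<noteq> 0}" by (auto simp: N_def)
  then have N: "finite N"
    using assms unfolding finitely_supported_def by (meson finite_imageD finite_subset inj_Suc inj_on_subset subset_UNIV)
  have "Lambert_fps \<gamma> = (\<Sum>n\<in>N. ?t n)"
    unfolding Lambert_fps_def by (rule suminf_finite[OF N]) (simp add: N_def)
  moreover have "fps_rational (\<Sum>n\<in>N. ?t n)"
    using N
  proof (induction N)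
    case empty
    have "(0 :: complex fps) * fps_of_poly 1 = fps_of_poly 0" by simp
    then show ?case unfolding fps_rational_altdef sum.empty by (metis poly_1 zero_neq_one)
  next
    case (insert n N)
    have "fps_rational (?t n + (\<Sum>n\<in>N. ?t n))"
      by (intro fps_rational_add fps_rational_Lambert_summand insert.IH) simp
    then show ?case using insert.hyps by (simp only: sum.insert not_False_eq_True)
  qed
  ultimately show ?thesis by simp
qed

lemma rational_imp_finitely_supported:
  assumes "fps_rational (Gamma_fps \<gamma>)" "fps_rational (Lambert_fps \<gamma>)"
  shows "finitely_supported \<gamma>"
proof -
  obtain s c m where u: "c 0 \<noteq> 0" "recurrence s c m (fps_nth (Gamma_fps \<gamma>))"
    using fps_rational_recurrence[OF assms(1)] .
  obtain s' c' m' where a: "recurrence s' c' m' (fps_nth (Lambert_fps \<gamma>))"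
    using fps_rational_recurrence[OF assms(2)] by metis
  have conv: "Lambert_fps \<gamma> $ n = (\<Sum>d | d dvd n. Gamma_fps \<gamma> $ d)" if "n > 0" for n
    using that by (auto simp: Lambert_fps_eq Gamma_fps_def intro!: sum.cong)
  have "\<gamma> n = 0" if "n \<ge> m" "n > 0" for n
    using recurrent_divisor_sum[OF u(2,1) a conv that] that by (simp add: Gamma_fps_def)
  then have "{n. n \<ge> 1 \<and> \<gamma> n \<noteq> 0} \<subseteq> {..<m}"
    by (metis (mono_tags, lifting) One_nat_def Suc_le_eq lessThan_iff linorder_not_less mem_Collect_eq subsetI)
  then show ?thesis unfolding finitely_supported_def using finite_subset by blast
qed

lemma finitely_supported_imp_polynomial:
  assumes "finitely_supported \<gamma>"
  shows "\<exists>p. Gamma_fps \<gamma> = fps_of_poly p"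
proof -
  have "{n. Gamma_fps \<gamma> $ n \<noteq> 0} \<subseteq> {n. n \<ge> 1 \<and> \<gamma> n \<noteq> 0}" by (auto simp: Gamma_fps_def)
  then have "finite {n. Gamma_fps \<gamma> $ n \<noteq> 0}"
    using assms unfolding finitely_supported_def by (rule finite_subset)
  then have "Gamma_fps \<gamma> = fps_of_poly (Abs_poly (fps_nth (Gamma_fps \<gamma>)))"
    by (intro fps_ext) (simp add: coeff_Abs_poly_If_le MOST_iff_cofinite Abs_poly_inverse)
  then show ?thesis by blast
qed

theorem corollary1p2:
  fixes \<gamma> :: "nat \<Rightarrow> complex"
  shows "(fps_rational (Gamma_fps \<gamma>) \<and> fps_rational (Lambert_fps \<gamma>) \<longrightarrow>
            (\<exists>p :: complex poly. Gamma_fps \<gamma> = fps_of_poly p)) \<and>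
         (fps_rational (Gamma_fps \<gamma>) \<longrightarrow>
            (fps_rational (Lambert_fps \<gamma>) \<longleftrightarrow> finitely_supported \<gamma>))"
  using rational_imp_finitely_supported finitely_supported_imp_Lambert_rational
    finitely_supported_imp_polynomial by blast

end
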